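(* Let $A\subset\mathbb{N}$ and let $\Phi$ be a Følner sequence on $\mathbb{N}$ such that $\mathsf{d}_\Phi(A)$ exists. For every $\epsilon>0$ there exist a subsequence $\Psi$ of $\Phi$ (which is again a Følner sequence) and a non-principal ultrafilter $\mathfrak{p}$ on $\mathbb{N}$ such that $\mathsf{d}_\Psi\big((A-m)\cap(A-\mathfrak{p})\big)$ exists for all $m\in\mathbb{N}$ and $$\lim_{m\to\mathfrak{p}}\mathsf{d}_\Psi\big((A-m)\cap(A-\mathfrak{p})\big)\ \ge\ \mathsf{d}_\Psi(A)^2-\epsilon.$$
   Context: A Følner sequence in $\mathbb{N}$ is a sequence $\Phi\colon N\mapsto\Phi_N$ of finite non-empty subsets of $\mathbb{N}$ with $|(\Phi_N+m)\triangle\Phi_N|/|\Phi_N|\to0$ for all $m\in\mathbb{N}$. For $E\subset\mathbb{N}$, $\mathsf{d}_\Phi(E)=\lim_{N\to\infty}|E\cap\Phi_N|/|\Phi_N|$ when the limit exists. For $m\in\mathbb{N}$, $A-m=\{n\in\mathbb{N}:n+m\in A\}$; for an ultrafilter $\mathfrak{p}$ on $\mathbb{N}$, $A-\mathfrak{p}=\{n\in\mathbb{N}: A-n\in\mathfrak{p}\}$, and $\lim_{m\to\mathfrak{p}}a(m)$ denotes the ultrafilter limit of a bounded real sequence $a$ (the unique $x$ with $\{m:|a(m)-x|<\delta\}\in\mathfrak{p}$ for all $\delta>0$). *)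

theory Defs
  imports Complex_Main
begin

definition folner :: "(nat \<Rightarrow> nat set) \<Rightarrow> bool" where
  "folner \<Phi> \<longleftrightarrow>
     (\<forall>N. finite (\<Phi> N) \<and> \<Phi> N \<noteq> {}) \<and>
     (\<forall>m::nat. (\<lambda>N. real (card ((((\<lambda>n. n + m) ` \<Phi> N) - \<Phi> N) \<union> (\<Phi> N - ((\<lambda>n. n + m) ` \<Phi> N))))
                      / real (card (\<Phi> N))) \<longlonglongrightarrow> 0)"

definition dens_seq :: "(nat \<Rightarrow> nat set) \<Rightarrow> nat set \<Rightarrow> nat \<Rightarrow> real" where
  "dens_seq \<Phi> E = (\<lambda>N. real (card (E \<inter> \<Phi> N)) / real (card (\<Phi> N)))"

definition dens_exists :: "(nat \<Rightarrow> nat set) \<Rightarrow> nat set \<Rightarrow> bool" where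
  "dens_exists \<Phi> E \<longleftrightarrow> convergent (dens_seq \<Phi> E)"

definition dens :: "(nat \<Rightarrow> nat set) \<Rightarrow> nat set \<Rightarrow> real" where
  "dens \<Phi> E = lim (dens_seq \<Phi> E)"

definition ultrafilter_nat :: "nat set set \<Rightarrow> bool" where
  "ultrafilter_nat p \<longleftrightarrow>
     UNIV \<in> p \<and> {} \<notin> p \<and>
     (\<forall>X Y. X \<in> p \<and> X \<subseteq> Y \<longrightarrow> Y \<in> p) \<and>
     (\<forall>X Y. X \<in> p \<and> Y \<in> p \<longrightarrow> X \<inter> Y \<in> p) \<and>
     (\<forall>X. X \<in> p \<or> - X \<in> p)"

definition nonprincipal :: "nat set set \<Rightarrow> bool" where
  "nonprincipal p \<longleftrightarrow> (\<forall>n::nat. {n} \<notin> p)"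

definition shift_set :: "nat set \<Rightarrow> nat \<Rightarrow> nat set" where
  "shift_set A m = {n. n + m \<in> A}"

definition shift_uf :: "nat set \<Rightarrow> nat set set \<Rightarrow> nat set" where
  "shift_uf A p = {n. shift_set A n \<in> p}"

definition ulim :: "nat set set \<Rightarrow> (nat \<Rightarrow> real) \<Rightarrow> real" where
  "ulim p a = (THE x. \<forall>\<delta>>0. {m. \<bar>a m - x\<bar> < \<delta>} \<in> p)"

end

theory Submission
  imports Defs "HOL-Analysis.Elementary_Topology"
begin

text \<open>
  Averaging over \<open>\<Phi>\<close> along an ultrafilter \<open>F\<close> gives a shift-invariant mean \<open>M\<close>. Let \<open>a\<close> be the
  indicator of \<open>A\<close>, and split \<open>a = P + w\<close>, where \<open>P\<close> almost minimises \<open>M ((a - P)\<^sup>2)\<close> among the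
  uniformly almost periodic functions. Then \<open>w\<close> is almost orthogonal to all almost periodic
  functions, so \<open>M (P a) \<ge> (M a)\<^sup>2\<close> up to a small error.

  Let \<open>c n t = M\<^sub>k (a (n + k) a (t + k))\<close> and \<open>q s t = M\<^sub>n (c n s c n t)\<close>. The mean ergodic theorem,
  applied to the positive definite kernel \<open>c\<^sup>2\<close>, shows that the averages defining \<open>q\<close> converge uniformly
  in \<open>s\<close> and \<open>t\<close>; hence \<open>q s\<close> is almost periodic, and
  near-orthogonality of \<open>w\<close> to every \<open>q s\<close> makes the average of \<open>w n w l c n l\<close> over \<open>n, l \<in> \<Phi> N\<close> small. This
  average is the mean square over \<open>k\<close> of the correlation of \<open>w\<close> with \<open>a (\<cdot> + k)\<close> on \<open>\<Phi> N\<close>, so for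
  most \<open>k\<close> that correlation is small, even simultaneously for the translates of \<open>w\<close> by \<open>m \<le> j\<close> along a fast
  sequence of scales \<open>N\<^sub>j\<close>. Moreover for a set of \<open>k\<close> of positive mean the average of \<open>P a\<close> over
  \<open>\<Phi> N\<^sub>j + k\<close> is almost \<open>M (P a)\<close> at all these scales.

  An ultrafilter \<open>p\<close> concentrated on such \<open>k\<close> works: by almost periodicity \<open>P (\<cdot> + m)\<close> converges
  uniformly as \<open>m \<rightarrow> p\<close>, hence the limits \<open>m \<rightarrow> p\<close> and \<open>k \<rightarrow> p\<close> of the structured part agree.
\<close>

section \<open>Ultrafilter limits and positive means\<close>

definition ultra :: "'a filter \<Rightarrow> bool" where
  "ultra F \<longleftrightarrow> F \<noteq> bot \<and> (\<forall>P. eventually P F \<or> eventually (\<lambda>x. \<not> P x) F)"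

lemma ultra_nontrivial: "ultra F \<Longrightarrow> F \<noteq> bot"
  by (simp add: ultra_def)

lemma ultra_not_eventually: "ultra F \<Longrightarrow> \<not> eventually P F \<Longrightarrow> eventually (\<lambda>x. \<not> P x) F"
  unfolding ultra_def by blast

lemma ultra_filtermap: "ultra F \<Longrightarrow> ultra (filtermap f F)"
  by (auto simp: ultra_def eventually_filtermap filtermap_bot_iff)

text \<open>Zorn's lemma for proper filters below \<open>F\<close>: an event that is eventual for
  the infimum of a nonempty chain is already eventual for one member, so that infimum is again
  proper.\<close>

lemma ultra_below:
  fixes F :: "'a filter"
  assumes "F \<noteq> bot"
  shows "\<exists>U \<le> F. ultra U"
proof -
  define S where "S = {U. U \<noteq> bot \<and> U \<le> F}"
  let ?R = "relation_of (\<lambda>x y. y \<le> x) S"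
  have "\<exists>m \<in> S. \<forall>a \<in> S. a \<le> m \<longrightarrow> a = m"
  proof (rule predicate_Zorn)
    show "partial_order_on S ?R"
      by (rule partial_order_on_relation_ofI) auto
  next
    fix C assume C: "C \<in> Chains ?R"
    show "\<exists>u\<in>S. \<forall>a\<in>C. u \<le> a"
    proof (cases "C = {}")
      case True
      then show ?thesis using assms by (auto simp: S_def)
    next
      case False
      have CS: "C \<subseteq> S" and lin: "\<And>x y. x \<in> C \<Longrightarrow> y \<in> C \<Longrightarrow> x \<le> y \<or> y \<le> x"
        using C by (auto simp: Chains_def relation_of_def)
      have "eventually P (Inf C) \<longleftrightarrow> (\<exists>b\<in>C. eventually P b)" for P
      proof (rule eventually_Inf_base[OF False])
        fix G H assume "G \<in> C" "H \<in> C"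
        then show "\<exists>x\<in>C. x \<le> inf G H"
          using lin[of G H] by (metis inf.absorb1 inf.absorb2 order_refl)
      qed
      then have "Inf C \<noteq> bot"
        using CS by (auto simp: trivial_limit_def S_def)
      moreover have "Inf C \<le> F"
        using False CS by (auto simp: S_def intro: Inf_lower2)
      ultimately show ?thesis
        by (intro bexI[of _ "Inf C"]) (auto simp: S_def intro: Inf_lower)
    qed
  qed
  then obtain U where U: "U \<in> S" and max: "\<And>V. V \<in> S \<Longrightarrow> V \<le> U \<Longrightarrow> V = U"
    by blast
  \<comment> \<open>Unless the negation of \<open>P\<close> is eventual, restricting
    \<open>U\<close> to the points satisfying \<open>P\<close> gives a proper filter below
    \<open>U\<close>, which minimality identifies with \<open>U\<close>.\<close>
  have "eventually P U" if np: "\<not> eventually (\<lambda>x. \<not> P x) U" for P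
  proof -
    have "inf U (principal {x. P x}) \<noteq> bot"
      using np by (simp add: trivial_limit_def eventually_inf_principal)
    then have "inf U (principal {x. P x}) = U"
      using U by (intro max) (auto simp: S_def le_infI1)
    moreover have "eventually P (inf U (principal {x. P x}))"
      by (simp add: eventually_inf_principal)
    ultimately show ?thesis by simp
  qed
  then show ?thesis using U unfolding S_def ultra_def by blast
qed

text \<open>Compactness of \<open>{-C..C}\<close> gives the image filter a cluster point, and an
  ultrafilter converges to each of its cluster points.\<close>

lemma ultra_bounded_tendsto:
  fixes f :: "'a \<Rightarrow> real"
  assumes "ultra F" and bd: "\<And>x. \<bar>f x\<bar> \<le> C"
  shows "\<exists>L. (f \<longlongrightarrow> L) F"
proof -
  have u: "ultra (filtermap f F)"
    by (rule ultra_filtermap[OF assms(1)])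
  have "eventually (\<lambda>y. y \<in> {-C..C}) (filtermap f F)"
    using bd by (auto simp: eventually_filtermap abs_le_iff minus_le_iff intro!: always_eventually)
  then obtain x where x: "inf (nhds x) (filtermap f F) \<noteq> bot"
    using compact_Icc[of "-C" C] ultra_nontrivial[OF u] unfolding compact_filter by blast
  have "filtermap f F \<le> nhds x"
  proof (rule filter_leI)
    fix P assume P: "eventually P (nhds x)"
    show "eventually P (filtermap f F)"
    proof (rule ccontr)
      assume "\<not> ?thesis"
      then have "eventually (\<lambda>x. \<not> P x) (filtermap f F)"
        by (rule ultra_not_eventually[OF u])
      then have "eventually (\<lambda>x. False) (inf (nhds x) (filtermap f F))"
        using P by (auto simp: eventually_inf)
      then show False using x by (simp add: trivial_limit_def)
    qed
  qed
  then show ?thesis by (auto simp: filterlim_def)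
qed

section \<open>Bounded functions and positive linear means\<close>

definition bdd :: "('a \<Rightarrow> real) \<Rightarrow> bool" where
  "bdd f \<longleftrightarrow> (\<exists>C. \<forall>x. \<bar>f x\<bar> \<le> C)"

lemma bddI: "(\<And>x. \<bar>f x\<bar> \<le> C) \<Longrightarrow> bdd f"
  by (auto simp: bdd_def)

lemma bddE:
  assumes "bdd f" obtains C where "C > 0" "\<And>x. \<bar>f x\<bar> \<le> C"
proof -
  obtain C where "\<And>x. \<bar>f x\<bar> \<le> C" using assms by (auto simp: bdd_def)
  then have "\<And>x. \<bar>f x\<bar> \<le> max C 1" by (simp add: le_max_iff_disj)
  then show ?thesis using that[of "max C 1"] by simp
qed

lemma bdd_const [simp]: "bdd (\<lambda>x. c)"
  by (auto simp: bdd_def)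

lemma bdd_compose: "bdd f \<Longrightarrow> bdd (\<lambda>x. f (g x))"
  by (auto simp: bdd_def)

lemma bdd_add [simp]: "bdd f \<Longrightarrow> bdd g \<Longrightarrow> bdd (\<lambda>x. f x + g x)"
proof (elim bddE)
  fix C D assume "\<And>x. \<bar>f x\<bar> \<le> C" "\<And>x. \<bar>g x\<bar> \<le> D"
  then show ?thesis
    by (intro bddI[of _ "C + D"] order_trans[OF abs_triangle_ineq] add_mono) auto
qed

lemma bdd_minus [simp]: "bdd f \<Longrightarrow> bdd (\<lambda>x. - f x)"
  by (auto simp: bdd_def)

lemma bdd_diff [simp]: "bdd f \<Longrightarrow> bdd g \<Longrightarrow> bdd (\<lambda>x. f x - g x)"
  using bdd_add[of f "\<lambda>x. - g x"] by simp

lemma bdd_mult [simp]: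
  assumes "bdd f" "bdd g" shows "bdd (\<lambda>x. f x * g x)"
proof -
  obtain C where C: "C > 0" "\<And>x. \<bar>f x\<bar> \<le> C" using bddE[OF assms(1)] by blast
  obtain D where D: "D > 0" "\<And>x. \<bar>g x\<bar> \<le> D" using bddE[OF assms(2)] by blast
  have "\<bar>f x * g x\<bar> \<le> C * D" for x
    unfolding abs_mult using C D by (intro mult_mono) (auto simp: less_imp_le)
  then show ?thesis by (rule bddI)
qed

lemma bdd_power2 [simp]: "bdd f \<Longrightarrow> bdd (\<lambda>x. (f x)\<^sup>2)"
  by (simp add: power2_eq_square)

lemma bdd_abs [simp]: "bdd f \<Longrightarrow> bdd (\<lambda>x. \<bar>f x\<bar>)"
  by (simp add: bdd_def)

lemma bdd_sum [simp]: "(\<And>i. i \<in> S \<Longrightarrow> bdd (f i)) \<Longrightarrow> bdd (\<lambda>x. \<Sum>i\<in>S. f i x)"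
  by (induction S rule: infinite_finite_induct) auto

lemma bdd_divide [simp]: "bdd f \<Longrightarrow> bdd (\<lambda>x. f x / c)"
  using bdd_mult[of f "\<lambda>x. 1/c"] by simp

lemma abs_le_of_square_le: "x\<^sup>2 \<le> y\<^sup>2 \<Longrightarrow> 0 \<le> y \<Longrightarrow> \<bar>x\<bar> \<le> (y::real)"
  using abs_le_square_iff[of x y] by simp

lemma abs_mult_le_1: "\<bar>x\<bar> \<le> 1 \<Longrightarrow> \<bar>y\<bar> \<le> 1 \<Longrightarrow> \<bar>x * y\<bar> \<le> (1::real)"
  by (simp add: abs_mult mult_le_one)

text \<open>For \<open>e > 0\<close> the minimiser \<open>t = - b / e\<close> gives the bound. This
  yields both Cauchy-Schwarz and the near-orthogonality of near-minimisers.\<close>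

lemma quadratic_discriminant:
  fixes a b e :: real
  assumes q: "\<And>t. 0 \<le> a + 2 * t * b + t\<^sup>2 * e" and e0: "0 \<le> e"
  shows "b\<^sup>2 \<le> a * e"
proof (cases "e = 0")
  case True
  have "b = 0"
  proof (rule ccontr)
    assume "b \<noteq> 0"
    \<comment> \<open>This value of \<open>t\<close> makes \<open>a + 2 * t * b\<close> equal to
      -1.\<close>
    then show False using q[of "- (a + 1) / (2 * b)"] True by (simp add: field_simps)
  qed
  then show ?thesis using True by simp
next
  case False
  then have "e > 0" using e0 by simp
  have "0 \<le> a - b\<^sup>2 / e"
    using q[of "- b / e"] False by (simp add: power2_eq_square field_simps)
  then show ?thesis using \<open>e > 0\<close> by (simp add: field_simps)
qed

text \<open>Finite averages, the invariant mean and its iterate on pairs share these laws, so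
  Cauchy-Schwarz is proved once for all of them. The laws concern bounded functions because
  ultralimits are guaranteed only there.\<close>

locale pos_mean =
  fixes L :: "('a \<Rightarrow> real) \<Rightarrow> real"
  assumes L_add: "bdd f \<Longrightarrow> bdd g \<Longrightarrow> L (\<lambda>x. f x + g x) = L f + L g"
    and L_cmult: "bdd f \<Longrightarrow> L (\<lambda>x. c * f x) = c * L f"
    and L_mono: "bdd f \<Longrightarrow> bdd g \<Longrightarrow> (\<And>x. f x \<le> g x) \<Longrightarrow> L f \<le> L g"
    and L_one: "L (\<lambda>x. 1) = 1"
begin

lemma L_const: "L (\<lambda>x. c) = c"
  using L_cmult[of "\<lambda>x. 1" c] L_one by simp

lemma L_cmult_right: "bdd f \<Longrightarrow> L (\<lambda>x. f x * c) = L f * c"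
  using L_cmult[of f c] by (simp add: mult.commute)

lemma L_divide: "bdd f \<Longrightarrow> L (\<lambda>x. f x / c) = L f / c"
  using L_cmult[of f "1/c"] by simp

lemma L_minus: "bdd f \<Longrightarrow> L (\<lambda>x. - f x) = - L f"
  using L_cmult[of f "-1"] by simp

lemma L_diff: "bdd f \<Longrightarrow> bdd g \<Longrightarrow> L (\<lambda>x. f x - g x) = L f - L g"
  using L_add[of f "\<lambda>x. - g x"] by (simp add: L_minus)

lemma L_sum: "(\<And>i. i \<in> S \<Longrightarrow> bdd (f i)) \<Longrightarrow> L (\<lambda>x. \<Sum>i\<in>S. f i x) = (\<Sum>i\<in>S. L (f i))"
  by (induction S rule: infinite_finite_induct) (auto simp: L_add L_const)

lemma L_nonneg: "bdd f \<Longrightarrow> (\<And>x. 0 \<le> f x) \<Longrightarrow> 0 \<le> L f"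
  using L_mono[of "\<lambda>x. 0" f] by (simp add: L_const)

lemma L_le_const: "(\<And>x. \<bar>f x\<bar> \<le> C) \<Longrightarrow> \<bar>L f\<bar> \<le> C"
  using L_mono[of f "\<lambda>x. C"] L_mono[of "\<lambda>x. - C" f] bddI[of f C]
  by (simp add: L_const abs_le_iff minus_le_iff)

lemma L_abs: "bdd f \<Longrightarrow> \<bar>L f\<bar> \<le> L (\<lambda>x. \<bar>f x\<bar>)"
  using L_mono[of f "\<lambda>x. \<bar>f x\<bar>"] L_mono[of "\<lambda>x. - f x" "\<lambda>x. \<bar>f x\<bar>"]
  by (simp add: L_minus abs_le_iff)

lemma L_square_add:
  assumes "bdd f" "bdd g"
  shows "L (\<lambda>x. (f x + t * g x)\<^sup>2) = L (\<lambda>x. (f x)\<^sup>2) + 2 * t * L (\<lambda>x. f x * g x) + t\<^sup>2 * L (\<lambda>x. (g x)\<^sup>2)"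
proof -
  have "(\<lambda>x. (f x + t * g x)\<^sup>2) = (\<lambda>x. (f x)\<^sup>2 + (2 * t) * (f x * g x) + t\<^sup>2 * (g x)\<^sup>2)"
    by (rule ext) (simp add: power2_eq_square algebra_simps)
  then show ?thesis using assms by (simp add: L_add L_cmult)
qed

lemma L_Cauchy_Schwarz:
  assumes f: "bdd f" and g: "bdd g"
  shows "(L (\<lambda>x. f x * g x))\<^sup>2 \<le> L (\<lambda>x. (f x)\<^sup>2) * L (\<lambda>x. (g x)\<^sup>2)"
proof -
  define a b e where "a = L (\<lambda>x. (f x)\<^sup>2)" and "b = L (\<lambda>x. f x * g x)" and "e = L (\<lambda>x. (g x)\<^sup>2)"
  have q: "0 \<le> a + 2 * t * b + t\<^sup>2 * e" for t
    using L_square_add[OF f g, of t] L_nonneg[of "\<lambda>x. (f x + t * g x)\<^sup>2"] f g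
    by (simp add: a_def b_def e_def)
  have e0: "0 \<le> e" using g by (simp add: e_def L_nonneg)
  have "b\<^sup>2 \<le> a * e" using q e0 by (rule quadratic_discriminant)
  then show ?thesis by (simp add: a_def b_def e_def)
qed

lemma L_square_le: "bdd f \<Longrightarrow> (L f)\<^sup>2 \<le> L (\<lambda>x. (f x)\<^sup>2)"
  using L_Cauchy_Schwarz[of f "\<lambda>x. 1"] by (simp add: L_const)

end

section \<open>Finite averages\<close>

definition avg :: "'i set \<Rightarrow> ('i \<Rightarrow> real) \<Rightarrow> real" where
  "avg S f = (\<Sum>i\<in>S. f i) / real (card S)"

lemma pos_mean_avg:
  assumes "finite S" "S \<noteq> {}"
  shows "pos_mean (avg S)"
proof
  show "avg S (\<lambda>x. 1) = 1" using assms by (simp add: avg_def)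
qed (auto simp: avg_def sum.distrib add_divide_distrib sum_distrib_left intro!: sum_mono divide_right_mono)

lemma avg_finite_mono:
  assumes "\<And>i. i \<in> S \<Longrightarrow> f i \<le> g i"
  shows "avg S f \<le> avg S g"
  unfolding avg_def using assms by (intro divide_right_mono sum_mono) auto

lemma bdd_avg [simp]: "(\<And>i. bdd (f i)) \<Longrightarrow> bdd (\<lambda>x. avg S (\<lambda>i. f i x))"
  unfolding avg_def by (intro bdd_divide bdd_sum) auto

lemma tendsto_avg:
  assumes "\<And>i. i \<in> S \<Longrightarrow> ((\<lambda>x. f x i) \<longlongrightarrow> l i) F"
  shows "((\<lambda>x. avg S (f x)) \<longlongrightarrow> avg S l) F"
  unfolding avg_def divide_inverse by (intro tendsto_intros assms)

lemma (in pos_mean) L_avg: "(\<And>i. bdd (f i)) \<Longrightarrow> L (\<lambda>x. avg S (\<lambda>i. f i x)) = avg S (\<lambda>i. L (f i))"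
  unfolding avg_def by (subst L_divide) (auto simp: L_sum)

lemma avg_swap: "avg S (\<lambda>i. avg T (\<lambda>j. f i j)) = avg T (\<lambda>j. avg S (\<lambda>i. f i j))"
  unfolding avg_def sum_divide_distrib by (subst sum.swap) (simp add: mult.commute)

lemma avg_mult_avg: "avg S f * avg T g = avg S (\<lambda>i. avg T (\<lambda>j. f i * g j))"
proof -
  have "avg T (\<lambda>j. f i * g j) = f i * avg T g" for i
    by (simp add: avg_def sum_distrib_left[symmetric])
  then show ?thesis
    by (simp add: avg_def[of S] sum_distrib_right[symmetric])
qed

section \<open>The invariant mean of a Folner sequence\<close>

text \<open>The sums over \<open>S\<close> and over its translate cancel on the intersection; only
  the symmetric difference contributes.\<close>

lemma avg_shift_diff:
  fixes f :: "nat \<Rightarrow> real"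
  assumes fin: "finite S" and bd: "\<And>n. \<bar>f n\<bar> \<le> C"
  shows "\<bar>avg S (\<lambda>n. f (n + m)) - avg S f\<bar>
    \<le> C * (real (card (((\<lambda>n. n + m) ` S - S) \<union> (S - (\<lambda>n. n + m) ` S))) / real (card S))"
proof -
  let ?T = "(\<lambda>n. n + m) ` S"
  have finT: "finite ?T" using fin by simp
  have C0: "0 \<le> C" using bd[of 0] by linarith
  have bdsum: "\<bar>sum f X\<bar> \<le> C * real (card X)" for X
  proof -
    have "\<bar>sum f X\<bar> \<le> (\<Sum>x\<in>X. \<bar>f x\<bar>)" by (rule sum_abs)
    also have "\<dots> \<le> (\<Sum>x\<in>X. C)" by (intro sum_mono bd)
    finally show ?thesis by (simp add: mult.commute)
  qed
  have "(\<Sum>n\<in>S. f (n + m)) = sum f ?T"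
    by (subst sum.reindex) (auto simp: inj_on_def)
  moreover have "sum f ?T = sum f (?T - S) + sum f (?T \<inter> S)"
    using finT by (metis add.commute sum.Int_Diff)
  moreover have "sum f S = sum f (S - ?T) + sum f (?T \<inter> S)"
    using fin by (metis add.commute inf_commute sum.Int_Diff)
  ultimately have "\<bar>(\<Sum>n\<in>S. f (n + m)) - sum f S\<bar> = \<bar>sum f (?T - S) - sum f (S - ?T)\<bar>"
    by simp
  also have "\<dots> \<le> C * real (card (?T - S)) + C * real (card (S - ?T))"
    using bdsum[of "?T - S"] bdsum[of "S - ?T"] by linarith
  also have "\<dots> = C * real (card ((?T - S) \<union> (S - ?T)))"
    using fin finT by (subst card_Un_disjoint) (auto simp: algebra_simps)
  finally have *: "\<bar>(\<Sum>n\<in>S. f (n + m)) - sum f S\<bar> \<le> C * real (card ((?T - S) \<union> (S - ?T)))" .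
  have "\<bar>avg S (\<lambda>n. f (n + m)) - avg S f\<bar> = \<bar>(\<Sum>n\<in>S. f (n + m)) - sum f S\<bar> / real (card S)"
    by (simp add: avg_def diff_divide_distrib[symmetric])
  also have "\<dots> \<le> C * real (card ((?T - S) \<union> (S - ?T))) / real (card S)"
    by (intro divide_right_mono *) simp
  finally show ?thesis by simp
qed

lemma abs_midpoint_le:
  "\<bar>u - z\<bar> \<le> p \<Longrightarrow> \<bar>v - z\<bar> \<le> q \<Longrightarrow> y = (u + v) / 2 \<Longrightarrow> \<bar>y - z\<bar> \<le> (p + q) / (2::real)"
  unfolding abs_le_iff by (auto simp: field_simps)

section \<open>The shift-invariant mean and the mean ergodic theorem\<close>

locale folner_ultra =
  fixes \<Phi> :: "nat \<Rightarrow> nat set" and F :: "nat filter"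
  assumes folner: "folner \<Phi>" and ultra: "ultra F" and F_le: "F \<le> sequentially"
begin

definition mean :: "(nat \<Rightarrow> real) \<Rightarrow> real" where
  "mean f = Lim F (\<lambda>N. avg (\<Phi> N) f)"

lemma F_nontrivial: "F \<noteq> bot"
  using ultra by (rule ultra_nontrivial)

lemma finite_\<Phi>: "finite (\<Phi> N)" and \<Phi>_nonempty: "\<Phi> N \<noteq> {}"
  using folner by (auto simp: folner_def)

lemma pos_mean_\<Phi>: "pos_mean (avg (\<Phi> N))"
  by (rule pos_mean_avg[OF finite_\<Phi> \<Phi>_nonempty])

sublocale av: pos_mean "avg (\<Phi> N)" for N
  by (rule pos_mean_\<Phi>)

lemma tendsto_F: "f \<longlonglongrightarrow> l \<Longrightarrow> (f \<longlongrightarrow> l) F"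
  by (rule tendsto_mono[OF F_le])

lemma mean_tendsto:
  assumes "bdd f" shows "((\<lambda>N. avg (\<Phi> N) f) \<longlongrightarrow> mean f) F"
proof -
  obtain C where "\<And>x. \<bar>f x\<bar> \<le> C" using assms by (auto simp: bdd_def)
  then obtain l where "((\<lambda>N. avg (\<Phi> N) f) \<longlongrightarrow> l) F"
    using ultra_bounded_tendsto[OF ultra] av.L_le_const by metis
  then show ?thesis by (simp add: mean_def tendsto_Lim[OF F_nontrivial])
qed

lemma meanI: "((\<lambda>N. avg (\<Phi> N) f) \<longlongrightarrow> l) F \<Longrightarrow> mean f = l"
  unfolding mean_def by (rule tendsto_Lim[OF F_nontrivial])

sublocale mean: pos_mean mean
proof
  fix f g :: "nat \<Rightarrow> real" and c :: real
  assume f: "bdd f"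
  show "mean (\<lambda>x. c * f x) = c * mean f"
    by (rule meanI) (simp add: av.L_cmult f tendsto_mult_left mean_tendsto)
  assume g: "bdd g"
  show "mean (\<lambda>x. f x + g x) = mean f + mean g"
    by (rule meanI) (simp add: av.L_add f g tendsto_add mean_tendsto)
  assume "\<And>x. f x \<le> g x"
  then show "mean f \<le> mean g"
    by (intro tendsto_le[OF F_nontrivial mean_tendsto[OF g] mean_tendsto[OF f]]
        always_eventually allI avg_finite_mono)
next
  show "mean (\<lambda>x. 1) = 1"
    by (rule meanI) (simp add: av.L_one)
qed

text \<open>The quantity that tends to zero in the Folner condition. It controls shift errors at a
  fixed \<open>N\<close>, uniformly over functions with a common bound.\<close>

definition fol :: "nat \<Rightarrow> nat \<Rightarrow> real" where
  "fol m N = real (card (((\<lambda>n. n + m) ` \<Phi> N - \<Phi> N) \<union> (\<Phi> N - (\<lambda>n. n + m) ` \<Phi> N))) / real (card (\<Phi> N))"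

lemma fol_tendsto: "(fol m \<longlongrightarrow> 0) F"
  using folner unfolding folner_def fol_def by (intro tendsto_F) blast

lemma avg_shift_fol:
  "(\<And>n. \<bar>f n\<bar> \<le> C) \<Longrightarrow> \<bar>avg (\<Phi> N) (\<lambda>n. f (n + m)) - avg (\<Phi> N) f\<bar> \<le> C * fol m N"
  unfolding fol_def by (rule avg_shift_diff[OF finite_\<Phi>])

lemma mean_shift:
  assumes f: "bdd f" shows "mean (\<lambda>n. f (n + m)) = mean f"
proof (rule meanI)
  obtain C where C: "\<And>x. \<bar>f x\<bar> \<le> C" using f by (auto simp: bdd_def)
  have "((\<lambda>N. C * fol m N) \<longlongrightarrow> 0) F"
    using tendsto_mult_left[OF fol_tendsto, of C m] by simp
  then have "((\<lambda>N. avg (\<Phi> N) (\<lambda>n. f (n + m)) - avg (\<Phi> N) f) \<longlongrightarrow> 0) F"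
    by (rule tendsto_0_le[of _ _ _ 1])
      (auto intro!: always_eventually order_trans[OF avg_shift_fol[OF C] abs_ge_self])
  from tendsto_add[OF this mean_tendsto[OF f]]
  show "((\<lambda>N. avg (\<Phi> N) (\<lambda>n. f (n + m))) \<longlongrightarrow> mean f) F" by simp
qed

lemma mean_shift_left: "bdd f \<Longrightarrow> mean (\<lambda>n. f (m + n)) = mean f"
  using mean_shift[of f m] by (simp add: add.commute)

lemma bdd_mean:
  assumes "\<And>x y. \<bar>f x y\<bar> \<le> C" shows "bdd (\<lambda>x. mean (f x))"
  by (rule bddI[of _ C]) (intro mean.L_le_const assms)

text \<open>
  The averages of \<open>e\<close> are asymptotically of minimal norm in the convex hull of the \<open>e i\<close>, so the
  parallelogram law makes them Cauchy.
\<close>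

lemma mean_ergodic:
  fixes L :: "('x \<Rightarrow> real) \<Rightarrow> real" and e :: "nat \<Rightarrow> 'x \<Rightarrow> real"
  assumes "pos_mean L" and bd: "\<And>i x. \<bar>e i x\<bar> \<le> C"
    and inv: "\<And>i j m. L (\<lambda>x. e (i + m) x * e (j + m) x) = L (\<lambda>x. e i x * e j x)"
    and "\<eta> > 0"
  shows "\<exists>G. eventually G F \<and> (\<forall>N N'. G N \<longrightarrow> G N' \<longrightarrow>
    L (\<lambda>x. (avg (\<Phi> N) (\<lambda>i. e i x) - avg (\<Phi> N') (\<lambda>i. e i x))\<^sup>2) \<le> \<eta>)"
proof -
  interpret L: pos_mean L by fact
  have C0: "0 \<le> C" using bd[of undefined undefined] by linarith
  define Z where "Z N x = avg (\<Phi> N) (\<lambda>i. e i x)" for N x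
  have be: "bdd (e i)" for i using bd by (rule bddI)
  have Zb: "\<bar>Z N x\<bar> \<le> C" for N x
    unfolding Z_def by (intro av.L_le_const bd)
  have bZ: "bdd (Z N)" for N using Zb by (rule bddI)
  have Z2b: "\<bar>L (\<lambda>x. (Z N x)\<^sup>2)\<bar> \<le> C\<^sup>2" for N
    using Zb by (intro L.L_le_const) (simp add: abs_le_square_iff[symmetric] C0)
  obtain I where I: "((\<lambda>N. L (\<lambda>x. (Z N x)\<^sup>2)) \<longlongrightarrow> I) F"
    using ultra_bounded_tendsto[OF ultra, of "\<lambda>N. L (\<lambda>x. (Z N x)\<^sup>2)", OF Z2b] by blast
  \<comment> \<open>No midpoint has squared norm below \<open>I\<close>: its translates have the
    same norm by \<open>inv\<close>, and averaging them over \<open>\<Phi> K\<close> gives almost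
    \<open>Z K\<close>.\<close>
  have I_le: "I \<le> L (\<lambda>x. ((Z N x + Z N' x) / 2)\<^sup>2)" for N N'
  proof -
    define T where "T n x = (avg (\<Phi> N) (\<lambda>i. e (i + n) x) + avg (\<Phi> N') (\<lambda>i. e (i + n) x)) / 2" for n x
    define v where "v = L (\<lambda>x. ((Z N x + Z N' x) / 2)\<^sup>2)"
    have avC: "\<bar>avg (\<Phi> M) (\<lambda>i. e (i + n) x)\<bar> \<le> C" for M n x
      by (intro av.L_le_const bd)
    have Tb: "\<bar>T n x\<bar> \<le> C" for n x
      using avC[of N n x] avC[of N' n x] by (simp add: T_def)
    have bT: "bdd (T n)" for n using Tb by (rule bddI)
    have LT: "L (\<lambda>x. (T n x)\<^sup>2) = v" for n
    proof -
      have cross: "L (\<lambda>x. avg (\<Phi> K) (\<lambda>i. e (i + n) x) * avg (\<Phi> K') (\<lambda>i. e (i + n) x))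
          = avg (\<Phi> K) (\<lambda>i. avg (\<Phi> K') (\<lambda>j. L (\<lambda>x. e i x * e j x)))" for K K' n
      proof -
        have "(\<lambda>x. avg (\<Phi> K) (\<lambda>i. e (i + n) x) * avg (\<Phi> K') (\<lambda>i. e (i + n) x))
          = (\<lambda>x. avg (\<Phi> K) (\<lambda>i. avg (\<Phi> K') (\<lambda>j. e (i + n) x * e (j + n) x)))"
          by (simp add: avg_mult_avg)
        then show ?thesis by (simp add: L.L_avg be inv)
      qed
      have val: "L (\<lambda>x. (T n x)\<^sup>2) =
        (L (\<lambda>x. avg (\<Phi> N) (\<lambda>i. e (i + n) x) * avg (\<Phi> N) (\<lambda>i. e (i + n) x))
        + 2 * L (\<lambda>x. avg (\<Phi> N) (\<lambda>i. e (i + n) x) * avg (\<Phi> N') (\<lambda>i. e (i + n) x))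
        + L (\<lambda>x. avg (\<Phi> N') (\<lambda>i. e (i + n) x) * avg (\<Phi> N') (\<lambda>i. e (i + n) x))) / 4" for n
      proof -
        have "(\<lambda>x. (T n x)\<^sup>2) = (\<lambda>x.
          (avg (\<Phi> N) (\<lambda>i. e (i + n) x) * avg (\<Phi> N) (\<lambda>i. e (i + n) x)
          + 2 * (avg (\<Phi> N) (\<lambda>i. e (i + n) x) * avg (\<Phi> N') (\<lambda>i. e (i + n) x))
          + avg (\<Phi> N') (\<lambda>i. e (i + n) x) * avg (\<Phi> N') (\<lambda>i. e (i + n) x)) / 4)"
          by (rule ext) (simp add: T_def power2_eq_square algebra_simps)
        then show ?thesis by (simp add: L.L_divide L.L_add L.L_cmult be)
      qed
      have "L (\<lambda>x. (T n x)\<^sup>2) = L (\<lambda>x. (T 0 x)\<^sup>2)"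
        unfolding val cross ..
      then show ?thesis by (simp add: v_def T_def Z_def)
    qed
    define \<delta> where "\<delta> K = (avg (\<Phi> N) (\<lambda>i. C * fol i K) + avg (\<Phi> N') (\<lambda>i. C * fol i K)) / 2" for K
    have \<delta>: "(\<delta> \<longlongrightarrow> 0) F"
    proof -
      have "(\<delta> \<longlongrightarrow> (avg (\<Phi> N) (\<lambda>i. C * 0) + avg (\<Phi> N') (\<lambda>i. C * 0)) / 2) F"
        unfolding \<delta>_def by (intro tendsto_intros tendsto_avg fol_tendsto) simp_all
      then show ?thesis by (simp add: av.L_const)
    qed
    \<comment> \<open>After the two averages are exchanged, each index \<open>i\<close> in
      \<open>\<Phi> N\<close> or \<open>\<Phi> N'\<close> merely shifts the average over
      \<open>\<Phi> K\<close>, at cost \<open>C * fol i K\<close>. The bound is uniform in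
      \<open>x\<close>.\<close>
    have close: "\<bar>avg (\<Phi> K) (\<lambda>n. T n x) - Z K x\<bar> \<le> \<delta> K" for K x
    proof -
      have part: "\<bar>avg (\<Phi> K) (\<lambda>n. avg (\<Phi> M) (\<lambda>i. e (i + n) x)) - Z K x\<bar> \<le> avg (\<Phi> M) (\<lambda>i. C * fol i K)" for M
      proof -
        have "avg (\<Phi> K) (\<lambda>n. avg (\<Phi> M) (\<lambda>i. e (i + n) x)) - Z K x
           = avg (\<Phi> M) (\<lambda>i. avg (\<Phi> K) (\<lambda>n. e (n + i) x) - Z K x)"
        proof -
          have b: "bdd (\<lambda>i. avg (\<Phi> K) (\<lambda>n. e (i + n) x))"
            by (rule bddI[of _ C]) (intro av.L_le_const bd)
          show ?thesis
            by (subst avg_swap) (simp add: av.L_diff b av.L_const add.commute)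
        qed
        also have "\<bar>\<dots>\<bar> \<le> avg (\<Phi> M) (\<lambda>i. \<bar>avg (\<Phi> K) (\<lambda>n. e (n + i) x) - Z K x\<bar>)"
          unfolding avg_def by (simp add: divide_right_mono)
        also have "\<dots> \<le> avg (\<Phi> M) (\<lambda>i. C * fol i K)"
          unfolding Z_def by (intro avg_finite_mono avg_shift_fol[of "\<lambda>n. e n x"] bd)
        finally show ?thesis .
      qed
      have "avg (\<Phi> K) (\<lambda>n. T n x) =
         (avg (\<Phi> K) (\<lambda>n. avg (\<Phi> N) (\<lambda>i. e (i + n) x)) + avg (\<Phi> K) (\<lambda>n. avg (\<Phi> N') (\<lambda>i. e (i + n) x))) / 2"
        unfolding T_def by (simp add: avg_def[of "\<Phi> K"] sum.distrib sum_divide_distrib[symmetric] add_divide_distrib)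
      then show ?thesis unfolding \<delta>_def by (rule abs_midpoint_le[OF part part])
    qed
    have \<delta>0: "0 \<le> \<delta> K" for K using close[of K undefined] by linarith
    have "L (\<lambda>x. (Z K x)\<^sup>2) \<le> v + (2 * C * \<delta> K + (\<delta> K)\<^sup>2)" for K
    proof -
      \<comment> \<open>Convexity of the square: the square of the averaged translates is at most
        the average of their squares.\<close>
      have "(Z K x)\<^sup>2 \<le> avg (\<Phi> K) (\<lambda>n. (T n x)\<^sup>2) + (2 * C * \<delta> K + (\<delta> K)\<^sup>2)" for x
      proof -
        define y where "y = avg (\<Phi> K) (\<lambda>n. T n x)"
        have y: "\<bar>y\<bar> \<le> C" unfolding y_def by (intro av.L_le_const Tb)
        have bTx: "bdd (\<lambda>n. T n x)" using Tb by (rule bddI)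
        have "\<bar>Z K x\<bar> \<le> \<bar>y\<bar> + \<delta> K" using close[of K x] unfolding y_def by linarith
        then have "(Z K x)\<^sup>2 \<le> (\<bar>y\<bar> + \<delta> K)\<^sup>2"
          by (metis abs_ge_zero power2_abs power_mono)
        also have "\<dots> = y\<^sup>2 + 2 * \<bar>y\<bar> * \<delta> K + (\<delta> K)\<^sup>2" by (simp add: power2_sum)
        also have "2 * \<bar>y\<bar> * \<delta> K \<le> 2 * C * \<delta> K"
          using y \<delta>0 by (intro mult_right_mono) auto
        also have "y\<^sup>2 \<le> avg (\<Phi> K) (\<lambda>n. (T n x)\<^sup>2)"
          unfolding y_def by (rule av.L_square_le[OF bTx])
        finally show ?thesis by simp
      qed
      then have "L (\<lambda>x. (Z K x)\<^sup>2) \<le> L (\<lambda>x. avg (\<Phi> K) (\<lambda>n. (T n x)\<^sup>2) + (2 * C * \<delta> K + (\<delta> K)\<^sup>2))"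
        by (intro L.L_mono) (auto simp: bZ bT)
      also have "\<dots> = avg (\<Phi> K) (\<lambda>n. v) + (2 * C * \<delta> K + (\<delta> K)\<^sup>2)"
        by (subst L.L_add) (auto simp: bT L.L_const L.L_avg LT)
      finally show ?thesis by (simp add: av.L_const)
    qed
    moreover have "((\<lambda>K. v + (2 * C * \<delta> K + (\<delta> K)\<^sup>2)) \<longlongrightarrow> v + (2 * C * 0 + 0\<^sup>2)) F"
      by (intro tendsto_intros \<delta>)
    ultimately have "I \<le> v + (2 * C * 0 + 0\<^sup>2)"
      by (intro tendsto_le[OF F_nontrivial _ I]) auto
    then show ?thesis by (simp add: v_def)
  qed
  define G where "G N \<longleftrightarrow> L (\<lambda>x. (Z N x)\<^sup>2) < I + \<eta> / 4" for N
  have "eventually G F"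
    unfolding G_def using \<open>\<eta> > 0\<close> by (intro order_tendstoD(2)[OF I]) simp
  moreover have "L (\<lambda>x. (Z N x - Z N' x)\<^sup>2) \<le> \<eta>" if "G N" "G N'" for N N'
  proof -
    \<comment> \<open>Parallelogram law; under \<open>G\<close> the result is at most
      \<open>4 * (I + \<eta> / 4) - 4 * I\<close>, which is \<open>\<eta>\<close>.\<close>
    have "(\<lambda>x. (Z N x - Z N' x)\<^sup>2) = (\<lambda>x. 2 * (Z N x)\<^sup>2 + 2 * (Z N' x)\<^sup>2 - 4 * ((Z N x + Z N' x) / 2)\<^sup>2)"
      by (rule ext) (simp add: power2_eq_square field_simps)
    then have "L (\<lambda>x. (Z N x - Z N' x)\<^sup>2)
      = 2 * L (\<lambda>x. (Z N x)\<^sup>2) + 2 * L (\<lambda>x. (Z N' x)\<^sup>2) - 4 * L (\<lambda>x. ((Z N x + Z N' x) / 2)\<^sup>2)"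
      by (simp add: L.L_diff L.L_add L.L_cmult bZ)
    then show ?thesis using that I_le[of N N'] unfolding G_def by linarith
  qed
  ultimately show ?thesis unfolding Z_def by blast
qed

end

section \<open>Almost periodic functions and correlations\<close>

text \<open>Uniform (Bohr) almost periodicity, stated through ultrafilters instead of finite nets of translates.\<close>

definition ap :: "(nat \<Rightarrow> real) \<Rightarrow> bool" where
  "ap f \<longleftrightarrow> bdd f \<and>
    (\<forall>p. ultra p \<longrightarrow> (\<exists>g. \<forall>\<eta>>0. \<forall>\<^sub>F m in p. \<forall>n. \<bar>f (n + m) - g n\<bar> \<le> \<eta>))"

lemma ap_bdd: "ap f \<Longrightarrow> bdd f"
  by (simp add: ap_def)

lemma ap_const: "ap (\<lambda>n. c)"
  unfolding ap_def by (auto intro!: exI[of _ "\<lambda>n. c"])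

lemma ap_add:
  assumes "ap f" "ap h" shows "ap (\<lambda>n. f n + h n)"
  unfolding ap_def
proof (intro conjI allI impI)
  show "bdd (\<lambda>n. f n + h n)" using assms by (simp add: ap_def)
  fix p :: "nat filter" assume p: "ultra p"
  obtain g1 where g1: "\<And>\<eta>. \<eta> > 0 \<Longrightarrow> \<forall>\<^sub>F m in p. \<forall>n. \<bar>f (n + m) - g1 n\<bar> \<le> \<eta>"
    using assms(1) p unfolding ap_def by blast
  obtain g2 where g2: "\<And>\<eta>. \<eta> > 0 \<Longrightarrow> \<forall>\<^sub>F m in p. \<forall>n. \<bar>h (n + m) - g2 n\<bar> \<le> \<eta>"
    using assms(2) p unfolding ap_def by blast
  show "\<exists>g. \<forall>\<eta>>0. \<forall>\<^sub>F m in p. \<forall>n. \<bar>f (n + m) + h (n + m) - g n\<bar> \<le> \<eta>"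
  proof (intro exI[of _ "\<lambda>n. g1 n + g2 n"] allI impI)
    fix \<eta> :: real assume "\<eta> > 0"
    then have "\<eta> / 2 > 0" by simp
    from g1[OF this] g2[OF this]
    show "\<forall>\<^sub>F m in p. \<forall>n. \<bar>f (n + m) + h (n + m) - (g1 n + g2 n)\<bar> \<le> \<eta>"
    proof eventually_elim
      case (elim m)
      show ?case
      proof
        fix n
        show "\<bar>f (n + m) + h (n + m) - (g1 n + g2 n)\<bar> \<le> \<eta>"
          using elim(1)[rule_format, of n] elim(2)[rule_format, of n] by linarith
      qed
    qed
  qed
qed

lemma ap_cmult:
  assumes "ap f" shows "ap (\<lambda>n. c * f n)"
  unfolding ap_def
proof (intro conjI allI impI)
  show "bdd (\<lambda>n. c * f n)" using assms by (simp add: ap_def)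
  fix p :: "nat filter" assume p: "ultra p"
  obtain g where g: "\<And>\<eta>. \<eta> > 0 \<Longrightarrow> \<forall>\<^sub>F m in p. \<forall>n. \<bar>f (n + m) - g n\<bar> \<le> \<eta>"
    using assms p unfolding ap_def by blast
  show "\<exists>g. \<forall>\<eta>>0. \<forall>\<^sub>F m in p. \<forall>n. \<bar>c * f (n + m) - g n\<bar> \<le> \<eta>"
  proof (intro exI[of _ "\<lambda>n. c * g n"] allI impI)
    fix \<eta> :: real assume "\<eta> > 0"
    then have "\<eta> / (\<bar>c\<bar> + 1) > 0" by (simp add: add_nonneg_pos)
    from g[OF this]
    show "\<forall>\<^sub>F m in p. \<forall>n. \<bar>c * f (n + m) - c * g n\<bar> \<le> \<eta>"
    proof eventually_elim
      case (elim m)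
      show ?case
      proof
        fix n
        have "\<bar>c * f (n + m) - c * g n\<bar> = \<bar>c\<bar> * \<bar>f (n + m) - g n\<bar>"
          by (simp add: abs_mult[symmetric] right_diff_distrib)
        also have "\<dots> \<le> \<bar>c\<bar> * (\<eta> / (\<bar>c\<bar> + 1))"
          using elim by (intro mult_left_mono) auto
        also have "\<dots> \<le> \<eta>" using \<open>\<eta> > 0\<close> by (simp add: field_simps)
        finally show "\<bar>c * f (n + m) - c * g n\<bar> \<le> \<eta>" .
      qed
    qed
  qed
qed

section \<open>Correlation kernels of a bounded function\<close>

locale folner_fun = folner_ultra +
  fixes a :: "nat \<Rightarrow> real"
  assumes a_abs: "\<bar>a n\<bar> \<le> 1"
begin

lemma bdd_a [simp]: "bdd (\<lambda>x. a (g x))"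
  using a_abs by (rule bddI)

text \<open>\<open>corr\<close> and \<open>corr2\<close> are the kernels \<open>c\<close> and
  \<open>q\<close> of the opening outline. Both are invariant under a common shift of their
  arguments, which on the naturals stands in for dependence on the difference alone.\<close>

definition corr :: "nat \<Rightarrow> nat \<Rightarrow> real" where
  "corr n t = mean (\<lambda>k. a (n + k) * a (t + k))"

definition corr2 :: "nat \<Rightarrow> nat \<Rightarrow> real" where
  "corr2 t s = mean (\<lambda>n. corr n t * corr n s)"

lemma corr_abs: "\<bar>corr n t\<bar> \<le> 1"
  unfolding corr_def by (intro mean.L_le_const abs_mult_le_1 a_abs)

lemma bdd_corr [simp]: "bdd (\<lambda>x. corr (f x) (g x))"
  using corr_abs by (rule bddI)

lemma corr_shift: "corr (n + m) (t + m) = corr n t"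
  using mean_shift_left[of "\<lambda>k. a (n + k) * a (t + k)" m] by (simp add: corr_def add.assoc)

lemma corr2_abs: "\<bar>corr2 t s\<bar> \<le> 1"
  unfolding corr2_def by (intro mean.L_le_const abs_mult_le_1 corr_abs)

lemma bdd_corr2 [simp]: "bdd (\<lambda>x. corr2 (f x) (g x))"
  using corr2_abs by (rule bddI)

lemma corr2_sym: "corr2 t s = corr2 s t"
  by (simp add: corr2_def mult.commute)

lemma corr2_shift: "corr2 (t + m) (s + m) = corr2 t s"
proof -
  have "corr2 (t + m) (s + m) = mean (\<lambda>n. corr (n + m) (t + m) * corr (n + m) (s + m))"
    unfolding corr2_def
    by (rule mean_shift[of "\<lambda>n. corr n (t + m) * corr n (s + m)", symmetric]) simp
  then show ?thesis by (simp add: corr_shift corr2_def)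
qed

lemma corr2_diag: "corr2 t t = corr2 0 0"
  using corr2_shift[of 0 t 0] by simp

text \<open>\<open>corr2\<close> is the Gram kernel of the functions
  \<open>\<lambda>n. corr n t\<close>, whose norms are all equal and at most 1. Cauchy-Schwarz
  leaves the squared distance of those with indices \<open>x\<close> and \<open>y\<close>.\<close>

lemma corr2_diff_square: "(corr2 t x - corr2 t y)\<^sup>2 \<le> 2 * (corr2 x x - corr2 x y)"
proof -
  have "corr2 t x - corr2 t y = mean (\<lambda>n. corr n t * (corr n x - corr n y))"
    unfolding corr2_def by (subst mean.L_diff[symmetric]) (auto simp: algebra_simps)
  then have "(corr2 t x - corr2 t y)\<^sup>2
      \<le> mean (\<lambda>n. (corr n t)\<^sup>2) * mean (\<lambda>n. (corr n x - corr n y)\<^sup>2)"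
    using mean.L_Cauchy_Schwarz[of "\<lambda>n. corr n t" "\<lambda>n. corr n x - corr n y"] by simp
  also have "\<dots> \<le> 1 * mean (\<lambda>n. (corr n x - corr n y)\<^sup>2)"
    using corr2_abs[of t t] by (intro mult_right_mono mean.L_nonneg) (auto simp: corr2_def power2_eq_square)
  also have "mean (\<lambda>n. (corr n x - corr n y)\<^sup>2) = corr2 x x + 2 * (-1) * corr2 x y + corr2 y y"
    using mean.L_square_add[of "\<lambda>n. corr n x" "\<lambda>n. corr n y" "-1"]
    by (simp add: corr2_def power2_eq_square)
  finally show ?thesis using corr2_diag[of x] corr2_diag[of y] by simp
qed

text \<open>This mean factors on products of functions of the two coordinates, so the square of a
  correlation becomes a single inner product.\<close>

definition mean2 :: "(nat \<times> nat \<Rightarrow> real) \<Rightarrow> real" where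
  "mean2 f = mean (\<lambda>k. mean (\<lambda>l. f (k, l)))"

lemma bdd_section: "bdd f \<Longrightarrow> bdd (\<lambda>l. f (k, l))"
  by (rule bdd_compose)

lemma bdd_mean_section: "bdd f \<Longrightarrow> bdd (\<lambda>k. mean (\<lambda>l. f (k, l)))"
  by (erule bddE) (rule bdd_mean)

lemma pos_mean2: "pos_mean mean2"
proof
  fix f g :: "nat \<times> nat \<Rightarrow> real" and c
  assume f: "bdd f"
  note f' = bdd_section[OF f] bdd_mean_section[OF f]
  show "mean2 (\<lambda>x. c * f x) = c * mean2 f"
    by (simp add: mean2_def mean.L_cmult f')
  assume g: "bdd g"
  note g' = bdd_section[OF g] bdd_mean_section[OF g]
  show "mean2 (\<lambda>x. f x + g x) = mean2 f + mean2 g"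
    by (simp add: mean2_def mean.L_add f' g')
  assume "\<And>x. f x \<le> g x"
  then show "mean2 f \<le> mean2 g"
    unfolding mean2_def by (intro mean.L_mono f' g') auto
qed (simp add: mean2_def mean.L_const)

sublocale mean2: pos_mean mean2
  by (rule pos_mean2)

lemma mean2_product:
  "bdd u \<Longrightarrow> bdd v \<Longrightarrow> mean2 (\<lambda>x. u (fst x) * v (snd x)) = mean u * mean v"
  by (simp add: mean2_def mean.L_cmult mean.L_cmult_right)

text \<open>The functions \<open>e i\<close> have the shift-invariant Gram matrix
  \<open>(corr i j)\<^sup>2\<close>, so their averages \<open>Z N\<close> are Cauchy in mean square.
  The averages in question are inner products of \<open>Z N\<close> with functions bounded by 1, and
  Cauchy-Schwarz makes their convergence uniform in \<open>t\<close> and \<open>s\<close>.\<close>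

lemma corr2_uniform:
  assumes "\<eta> > 0"
  shows "\<forall>\<^sub>F N in F. \<forall>t s. \<bar>avg (\<Phi> N) (\<lambda>n. corr n t * corr n s) - corr2 t s\<bar> \<le> \<eta>"
proof -
  define e where "e i x = a (i + fst x) * a (i + snd x)" for i and x :: "nat \<times> nat"
  define Z where "Z N x = avg (\<Phi> N) (\<lambda>i. e i x)" for N x
  have e_abs: "\<bar>e i x\<bar> \<le> 1" for i x
    unfolding e_def by (intro abs_mult_le_1 a_abs)
  have be [simp]: "bdd (e i)" for i using e_abs by (rule bddI)
  have bZ [simp]: "bdd (Z N)" for N unfolding Z_def by simp
  have ee: "mean2 (\<lambda>x. e i x * e j x) = corr i j * corr i j" for i j
  proof -
    have "(\<lambda>x. e i x * e j x) = (\<lambda>x. (a (i + fst x) * a (j + fst x)) * (a (i + snd x) * a (j + snd x)))"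
      by (simp add: e_def mult_ac)
    then show ?thesis
      using mean2_product[of "\<lambda>k. a (i + k) * a (j + k)" "\<lambda>k. a (i + k) * a (j + k)"]
      by (simp add: corr_def)
  qed
  have inv: "mean2 (\<lambda>x. e (i + m) x * e (j + m) x) = mean2 (\<lambda>x. e i x * e j x)" for i j m
    by (simp add: ee corr_shift)
  have "\<eta>\<^sup>2 > 0" using assms by simp
  from mean_ergodic[of mean2 e 1, OF pos_mean2 e_abs inv this]
  obtain G where G: "eventually G F"
    and GZ: "\<And>N N'. G N \<Longrightarrow> G N' \<Longrightarrow> mean2 (\<lambda>x. (Z N x - Z N' x)\<^sup>2) \<le> \<eta>\<^sup>2"
    unfolding Z_def by blast
  have rep: "avg (\<Phi> N) (\<lambda>n. corr n t * corr n s) = mean2 (\<lambda>x. a (t + fst x) * a (s + snd x) * Z N x)" for N t s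
  proof -
    have "(\<lambda>x. a (t + fst x) * a (s + snd x) * Z N x)
      = (\<lambda>x. avg (\<Phi> N) (\<lambda>n. (a (n + fst x) * a (t + fst x)) * (a (n + snd x) * a (s + snd x))))"
      by (rule ext) (simp add: Z_def e_def avg_def sum_distrib_left mult_ac)
    moreover have "mean2 (\<lambda>x. (a (n + fst x) * a (t + fst x)) * (a (n + snd x) * a (s + snd x))) = corr n t * corr n s" for n
      using mean2_product[of "\<lambda>k. a (n + k) * a (t + k)" "\<lambda>k. a (n + k) * a (s + k)"]
      by (simp add: corr_def)
    ultimately show ?thesis by (simp add: mean2.L_avg)
  qed
  have close: "\<bar>avg (\<Phi> N) (\<lambda>n. corr n t * corr n s) - avg (\<Phi> N') (\<lambda>n. corr n t * corr n s)\<bar> \<le> \<eta>"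
    if "G N" "G N'" for N N' t s
  proof -
    have "avg (\<Phi> N) (\<lambda>n. corr n t * corr n s) - avg (\<Phi> N') (\<lambda>n. corr n t * corr n s)
      = mean2 (\<lambda>x. a (t + fst x) * a (s + snd x) * (Z N x - Z N' x))"
      unfolding rep by (subst mean2.L_diff[symmetric]) (auto simp: algebra_simps)
    then have "(avg (\<Phi> N) (\<lambda>n. corr n t * corr n s) - avg (\<Phi> N') (\<lambda>n. corr n t * corr n s))\<^sup>2
      \<le> mean2 (\<lambda>x. (a (t + fst x) * a (s + snd x))\<^sup>2) * mean2 (\<lambda>x. (Z N x - Z N' x)\<^sup>2)"
      using mean2.L_Cauchy_Schwarz[of "\<lambda>x. a (t + fst x) * a (s + snd x)" "\<lambda>x. Z N x - Z N' x"] by simp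
    also have "\<dots> \<le> 1 * \<eta>\<^sup>2"
    proof (intro mult_mono GZ that mean2.L_nonneg)
      have "\<bar>mean2 (\<lambda>x. (a (t + fst x) * a (s + snd x))\<^sup>2)\<bar> \<le> 1"
        unfolding power2_eq_square by (intro mean2.L_le_const abs_mult_le_1 a_abs)
      then show "mean2 (\<lambda>x. (a (t + fst x) * a (s + snd x))\<^sup>2) \<le> 1" by simp
    qed auto
    finally show ?thesis using assms by (simp add: abs_le_square_iff[symmetric])
  qed
  show ?thesis
    using G
  proof eventually_elim
    case (elim N)
    show ?case
    proof (intro allI)
      fix t s
      \<comment> \<open>Letting \<open>N'\<close> run along \<open>F\<close> turns the Cauchy
        estimate into a comparison with \<open>corr2 t s\<close>.\<close>
      have "((\<lambda>N'. \<bar>avg (\<Phi> N) (\<lambda>n. corr n t * corr n s) - avg (\<Phi> N') (\<lambda>n. corr n t * corr n s)\<bar>)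
        \<longlongrightarrow> \<bar>avg (\<Phi> N) (\<lambda>n. corr n t * corr n s) - corr2 t s\<bar>) F"
        unfolding corr2_def by (intro tendsto_intros mean_tendsto) simp
      then show "\<bar>avg (\<Phi> N) (\<lambda>n. corr n t * corr n s) - corr2 t s\<bar> \<le> \<eta>"
        by (rule tendsto_upperbound[OF _ _ F_nontrivial])
          (use G in \<open>auto elim!: eventually_mono intro: close elim\<close>)
    qed
  qed
qed

text \<open>Precompactness in the uniform norm: for one suitable \<open>N\<close>, the function
  \<open>corr2 t\<close> is determined up to a small uniform error by the finitely many numbers
  \<open>corr n t\<close> with \<open>n \<in> \<Phi> N\<close>.\<close>

lemma corr2_compact:
  assumes p: "ultra p" and "\<eta> > 0"
  shows "\<exists>s. \<forall>\<^sub>F t in p. \<forall>n. \<bar>corr2 t n - corr2 s n\<bar> \<le> \<eta>"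
proof -
  have "\<eta> / 3 > 0" using assms by simp
  from eventually_happens[OF corr2_uniform[OF this]] F_nontrivial
  obtain N where N: "\<And>t s. \<bar>avg (\<Phi> N) (\<lambda>n. corr n t * corr n s) - corr2 t s\<bar> \<le> \<eta> / 3"
    by auto
  have "\<exists>l. ((\<lambda>t. corr n t) \<longlongrightarrow> l) p" for n
    using ultra_bounded_tendsto[OF p, of "\<lambda>t. corr n t", OF corr_abs] .
  then obtain \<gamma> where \<gamma>: "\<And>n. ((\<lambda>t. corr n t) \<longlongrightarrow> \<gamma> n) p" by metis
  have ev: "\<forall>\<^sub>F t in p. \<forall>n\<in>\<Phi> N. \<bar>corr n t - \<gamma> n\<bar> < \<eta> / 6"
  proof (rule eventually_ball_finite[OF finite_\<Phi>], rule ballI)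
    fix n
    show "\<forall>\<^sub>F t in p. \<bar>corr n t - \<gamma> n\<bar> < \<eta> / 6"
      using tendstoD[OF \<gamma>[of n], of "\<eta> / 6"] \<open>\<eta> > 0\<close> by (simp add: dist_real_def)
  qed
  from eventually_happens[OF ev] ultra_nontrivial[OF p]
  obtain s where s: "\<And>n. n \<in> \<Phi> N \<Longrightarrow> \<bar>corr n s - \<gamma> n\<bar> < \<eta> / 6" by auto
  show ?thesis
  proof (intro exI)
    show "\<forall>\<^sub>F t in p. \<forall>n. \<bar>corr2 t n - corr2 s n\<bar> \<le> \<eta>"
      using ev
    proof eventually_elim
      case (elim t)
      show ?case
      proof
        fix x
        have "\<bar>avg (\<Phi> N) (\<lambda>n. corr n t * corr n x) - avg (\<Phi> N) (\<lambda>n. corr n s * corr n x)\<bar>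
          = \<bar>avg (\<Phi> N) (\<lambda>n. (corr n t - corr n s) * corr n x)\<bar>"
          by (subst av.L_diff[symmetric]) (auto simp: algebra_simps)
        also have "\<dots> \<le> avg (\<Phi> N) (\<lambda>n. \<bar>(corr n t - corr n s) * corr n x\<bar>)"
          by (rule av.L_abs) simp
        also have "\<dots> \<le> avg (\<Phi> N) (\<lambda>n. \<eta> / 3)"
        proof (rule avg_finite_mono)
          fix n assume n: "n \<in> \<Phi> N"
          have "\<bar>corr n t - corr n s\<bar> \<le> \<eta> / 3"
            using s[OF n] elim[rule_format, OF n] by linarith
          then have "\<bar>corr n t - corr n s\<bar> * \<bar>corr n x\<bar> \<le> \<eta> / 3 * 1"
            using corr_abs[of n x] \<open>\<eta> > 0\<close> by (intro mult_mono) auto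
          then show "\<bar>(corr n t - corr n s) * corr n x\<bar> \<le> \<eta> / 3"
            by (simp add: abs_mult)
        qed
        also have "\<dots> = \<eta> / 3" by (rule av.L_const)
        finally show "\<bar>corr2 t x - corr2 s x\<bar> \<le> \<eta>"
          using N[of t x] N[of s x] by linarith
      qed
    qed
  qed
qed

text \<open>Shift invariance converts precompactness in the index into almost periodicity in the
  argument: the change of \<open>corr2 t\<close> from \<open>n + s\<close> to \<open>n + m\<close>
  is controlled by \<open>corr2 m m - corr2 s m\<close>, independently of \<open>n\<close>.\<close>

lemma ap_corr2: "ap (corr2 t)"
  unfolding ap_def
proof (intro conjI allI impI)
  show "bdd (corr2 t)" by simp
  fix p :: "nat filter" assume p: "ultra p"
  have "\<exists>l. ((\<lambda>m. corr2 t (n + m)) \<longlongrightarrow> l) p" for n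
    using ultra_bounded_tendsto[OF p, of "\<lambda>m. corr2 t (n + m)", OF corr2_abs] .
  then obtain g where g: "\<And>n. ((\<lambda>m. corr2 t (n + m)) \<longlongrightarrow> g n) p" by metis
  show "\<exists>g. \<forall>\<eta>>0. \<forall>\<^sub>F m in p. \<forall>n. \<bar>corr2 t (n + m) - g n\<bar> \<le> \<eta>"
  proof (intro exI[of _ g] allI impI)
    fix \<eta> :: real assume \<eta>: "\<eta> > 0"
    then have "\<eta>\<^sup>2 / 8 > 0" by simp
    from corr2_compact[OF p this] obtain s where
      s: "\<forall>\<^sub>F m in p. \<forall>n. \<bar>corr2 m n - corr2 s n\<bar> \<le> \<eta>\<^sup>2 / 8" by blast
    have ev: "\<forall>\<^sub>F m in p. \<forall>n. \<bar>corr2 t (n + m) - corr2 t (n + s)\<bar> \<le> \<eta> / 2"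
      using s
    proof eventually_elim
      case (elim m)
      show ?case
      proof
        fix n
        have "(corr2 t (n + m) - corr2 t (n + s))\<^sup>2 \<le> 2 * (corr2 (n + m) (n + m) - corr2 (n + m) (n + s))"
          by (rule corr2_diff_square)
        also have "\<dots> = 2 * (corr2 m m - corr2 s m)"
          using corr2_shift[of m n m] corr2_shift[of m n s] corr2_sym[of m s] by (simp add: add.commute)
        \<comment> \<open>The compactness estimate is evaluated at the moving argument
          \<open>m\<close>, which its uniformity allows; \<open>2 * (\<eta>\<^sup>2 / 8)\<close> is
          \<open>(\<eta> / 2)\<^sup>2\<close>.\<close>
        also have "\<dots> \<le> (\<eta> / 2)\<^sup>2"
          using abs_le_D1[OF elim[rule_format, of m]] by (simp add: power2_eq_square)
        finally show "\<bar>corr2 t (n + m) - corr2 t (n + s)\<bar> \<le> \<eta> / 2"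
          using \<eta> by (simp add: abs_le_square_iff[symmetric])
      qed
    qed
    have gs: "\<bar>g n - corr2 t (n + s)\<bar> \<le> \<eta> / 2" for n
    proof (rule tendsto_upperbound[OF _ _ ultra_nontrivial[OF p]])
      show "((\<lambda>m. \<bar>corr2 t (n + m) - corr2 t (n + s)\<bar>) \<longlongrightarrow> \<bar>g n - corr2 t (n + s)\<bar>) p"
        by (intro tendsto_intros g)
      show "\<forall>\<^sub>F m in p. \<bar>corr2 t (n + m) - corr2 t (n + s)\<bar> \<le> \<eta> / 2"
        using ev by eventually_elim blast
    qed
    show "\<forall>\<^sub>F m in p. \<forall>n. \<bar>corr2 t (n + m) - g n\<bar> \<le> \<eta>"
      using ev
    proof eventually_elim
      case (elim m)
      show ?case
      proof
        fix n
        show "\<bar>corr2 t (n + m) - g n\<bar> \<le> \<eta>"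
          using elim[rule_format, of n] gs[of n] by linarith
      qed
    qed
  qed
qed

text \<open>Cauchy-Schwarz removes the factor \<open>w n\<close>. In the remaining square, averaging
  over \<open>n\<close> turns \<open>corr n l * corr n j\<close> into nearly
  \<open>corr2 l j\<close>, to which \<open>w\<close> is almost orthogonal.\<close>

lemma corr_form_small:
  assumes w: "bdd w" and w2: "mean (\<lambda>n. (w n)\<^sup>2) \<le> 2" and "\<rho> > 0"
    and orth: "\<And>t. \<bar>mean (\<lambda>n. w n * corr2 t n)\<bar> \<le> \<rho>"
  shows "\<forall>\<^sub>F N in F. (avg (\<Phi> N) (\<lambda>n. avg (\<Phi> N) (\<lambda>l. w n * w l * corr n l)))\<^sup>2 \<le> 36 * \<rho>"
proof -
  have ev2: "\<forall>\<^sub>F N in F. avg (\<Phi> N) (\<lambda>n. (w n)\<^sup>2) < 3"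
    using order_tendstoD(2)[OF mean_tendsto, of "\<lambda>n. (w n)\<^sup>2" 3] w w2 by simp
  have w1: "avg (\<Phi> N) (\<lambda>n. \<bar>w n\<bar>) \<le> 2" if "avg (\<Phi> N) (\<lambda>n. (w n)\<^sup>2) < 3" for N
  proof -
    have "(avg (\<Phi> N) (\<lambda>n. \<bar>w n\<bar>))\<^sup>2 \<le> avg (\<Phi> N) (\<lambda>n. \<bar>w n\<bar>\<^sup>2)"
      using w by (intro av.L_square_le) simp
    also have "\<dots> \<le> 2\<^sup>2" using that by simp
    finally show ?thesis by (rule power2_le_imp_le) simp
  qed
  \<comment> \<open>Otherwise a bad index \<open>\<tau> N\<close> exists for \<open>F\<close>-most
    \<open>N\<close>, and precompactness replaces \<open>corr2 (\<tau> N)\<close> by a single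
    \<open>corr2 s\<close>, against \<open>orth\<close>. The constant 4 is 2 for the average at
    \<open>s\<close> plus 2 for the replacement, as \<open>\<bar>w\<bar>\<close> averages to at most
    2.\<close>
  have ev3: "\<forall>\<^sub>F N in F. \<forall>t. \<bar>avg (\<Phi> N) (\<lambda>n. w n * corr2 t n)\<bar> \<le> 4 * \<rho>"
  proof (rule ccontr)
    assume "\<not> ?thesis"
    from ultra_not_eventually[OF ultra this]
    have "\<forall>\<^sub>F N in F. \<exists>t. \<bar>avg (\<Phi> N) (\<lambda>n. w n * corr2 t n)\<bar> > 4 * \<rho>"
      by (simp add: not_le)
    then obtain \<tau> where \<tau>: "\<forall>\<^sub>F N in F. \<bar>avg (\<Phi> N) (\<lambda>n. w n * corr2 (\<tau> N) n)\<bar> > 4 * \<rho>"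
      unfolding eventually_ex by blast
    obtain s where s: "\<forall>\<^sub>F N in F. \<forall>n. \<bar>corr2 (\<tau> N) n - corr2 s n\<bar> \<le> \<rho>"
      using corr2_compact[OF ultra_filtermap[OF ultra] \<open>\<rho> > 0\<close>, of \<tau>]
      by (auto simp: eventually_filtermap)
    have "((\<lambda>N. \<bar>avg (\<Phi> N) (\<lambda>n. w n * corr2 s n)\<bar>) \<longlongrightarrow> \<bar>mean (\<lambda>n. w n * corr2 s n)\<bar>) F"
      using w by (intro tendsto_rabs mean_tendsto) simp
    then have "\<forall>\<^sub>F N in F. \<bar>avg (\<Phi> N) (\<lambda>n. w n * corr2 s n)\<bar> < 2 * \<rho>"
      using orth[of s] \<open>\<rho> > 0\<close> by (intro order_tendstoD(2)) auto
    with \<tau> s ev2 have "\<forall>\<^sub>F N in F. False"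
    proof eventually_elim
      case (elim N)
      have "avg (\<Phi> N) (\<lambda>n. w n * corr2 (\<tau> N) n) - avg (\<Phi> N) (\<lambda>n. w n * corr2 s n)
        = avg (\<Phi> N) (\<lambda>n. w n * (corr2 (\<tau> N) n - corr2 s n))"
        using w by (subst av.L_diff[symmetric]) (auto simp: algebra_simps)
      also have "\<bar>\<dots>\<bar> \<le> avg (\<Phi> N) (\<lambda>n. \<bar>w n * (corr2 (\<tau> N) n - corr2 s n)\<bar>)"
        using w by (intro av.L_abs) simp
      also have "\<dots> \<le> avg (\<Phi> N) (\<lambda>n. \<bar>w n\<bar> * \<rho>)"
        using elim(2) by (intro avg_finite_mono) (auto simp: abs_mult intro: mult_left_mono)
      also have "\<dots> = avg (\<Phi> N) (\<lambda>n. \<bar>w n\<bar>) * \<rho>"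
        using w by (simp add: av.L_cmult_right)
      also have "\<dots> \<le> 2 * \<rho>"
        using w1[OF elim(3)] \<open>\<rho> > 0\<close> by simp
      finally show ?case using elim(1,4) by linarith
    qed
    then show False using F_nontrivial by simp
  qed
  show ?thesis
    using ev2 ev3 corr2_uniform[OF \<open>\<rho> > 0\<close>]
  proof eventually_elim
    case (elim N)
    define y where "y n = avg (\<Phi> N) (\<lambda>l. w l * corr n l)" for n
    have y: "bdd y" using w unfolding y_def by (intro bdd_avg) simp
    have "avg (\<Phi> N) (\<lambda>n. avg (\<Phi> N) (\<lambda>l. w n * w l * corr n l)) = avg (\<Phi> N) (\<lambda>n. w n * y n)"
      using w by (simp add: y_def av.L_cmult mult.assoc)
    then have "(avg (\<Phi> N) (\<lambda>n. avg (\<Phi> N) (\<lambda>l. w n * w l * corr n l)))\<^sup>2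
      \<le> avg (\<Phi> N) (\<lambda>n. (w n)\<^sup>2) * avg (\<Phi> N) (\<lambda>n. (y n)\<^sup>2)"
      using av.L_Cauchy_Schwarz[OF w y] by simp
    \<comment> \<open>The 3 comes from \<open>ev2\<close>. The 12 is 2, the bound on the average of
      \<open>\<bar>w\<bar>\<close>, times the sum of 4 from \<open>ev3\<close> and 2 from replacing
      averages by \<open>corr2\<close>.\<close>
    also have "\<dots> \<le> 3 * (12 * \<rho>)"
    proof (intro mult_mono av.L_nonneg)
      have "(y n)\<^sup>2 = avg (\<Phi> N) (\<lambda>l. avg (\<Phi> N) (\<lambda>j. (w l * w j) * (corr n l * corr n j)))" for n
        unfolding power2_eq_square y_def avg_mult_avg by (simp add: mult_ac)
      then have "avg (\<Phi> N) (\<lambda>n. (y n)\<^sup>2) =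
          avg (\<Phi> N) (\<lambda>l. avg (\<Phi> N) (\<lambda>j. avg (\<Phi> N) (\<lambda>n. (w l * w j) * (corr n l * corr n j))))"
        by (simp add: avg_swap[of "\<Phi> N" "\<Phi> N", where f = "\<lambda>n l. avg (\<Phi> N) (\<lambda>j. w l * w j * (corr n l * corr n j))"])
          (subst avg_swap, rule refl)
      also have "\<dots> = avg (\<Phi> N) (\<lambda>l. avg (\<Phi> N) (\<lambda>j. (w l * w j) * avg (\<Phi> N) (\<lambda>n. corr n l * corr n j)))"
        by (simp add: av.L_cmult)
      also have "\<dots> \<le> avg (\<Phi> N) (\<lambda>l. 4 * \<rho> * \<bar>w l\<bar> + 2 * \<rho> * \<bar>w l\<bar>)"
      proof (rule avg_finite_mono)
        fix l
        have "avg (\<Phi> N) (\<lambda>j. (w l * w j) * avg (\<Phi> N) (\<lambda>n. corr n l * corr n j))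
          \<le> avg (\<Phi> N) (\<lambda>j. w l * (w j * corr2 l j) + \<bar>w l\<bar> * \<rho> * \<bar>w j\<bar>)"
        proof (rule avg_finite_mono)
          fix j
          define D where "D = avg (\<Phi> N) (\<lambda>n. corr n l * corr n j) - corr2 l j"
          have "(w l * w j) * D \<le> \<bar>w l * w j\<bar> * \<bar>D\<bar>" by (metis abs_ge_self abs_mult)
          also have "\<dots> \<le> \<bar>w l * w j\<bar> * \<rho>"
            using elim(3) unfolding D_def by (intro mult_left_mono) auto
          finally have "(w l * w j) * D \<le> \<bar>w l\<bar> * \<rho> * \<bar>w j\<bar>" by (simp add: abs_mult mult_ac)
          then show "(w l * w j) * avg (\<Phi> N) (\<lambda>n. corr n l * corr n j) \<le> w l * (w j * corr2 l j) + \<bar>w l\<bar> * \<rho> * \<bar>w j\<bar>"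
            unfolding D_def by (simp add: algebra_simps)
        qed
        also have "\<dots> = w l * avg (\<Phi> N) (\<lambda>j. w j * corr2 l j) + \<bar>w l\<bar> * \<rho> * avg (\<Phi> N) (\<lambda>j. \<bar>w j\<bar>)"
          using w by (simp add: av.L_add av.L_cmult)
        also have "\<dots> \<le> \<bar>w l\<bar> * (4 * \<rho>) + \<bar>w l\<bar> * \<rho> * 2"
        proof (rule add_mono)
          have "w l * avg (\<Phi> N) (\<lambda>j. w j * corr2 l j) \<le> \<bar>w l\<bar> * \<bar>avg (\<Phi> N) (\<lambda>j. w j * corr2 l j)\<bar>"
            by (metis abs_ge_self abs_mult)
          also have "\<dots> \<le> \<bar>w l\<bar> * (4 * \<rho>)" using elim(2) by (intro mult_left_mono) auto
          finally show "w l * avg (\<Phi> N) (\<lambda>j. w j * corr2 l j) \<le> \<bar>w l\<bar> * (4 * \<rho>)" .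
          show "\<bar>w l\<bar> * \<rho> * avg (\<Phi> N) (\<lambda>j. \<bar>w j\<bar>) \<le> \<bar>w l\<bar> * \<rho> * 2"
            using w1[OF elim(1)] \<open>\<rho> > 0\<close> by (intro mult_left_mono) auto
        qed
        finally show "avg (\<Phi> N) (\<lambda>j. (w l * w j) * avg (\<Phi> N) (\<lambda>n. corr n l * corr n j))
          \<le> 4 * \<rho> * \<bar>w l\<bar> + 2 * \<rho> * \<bar>w l\<bar>" by (simp add: mult_ac)
      qed
      also have "\<dots> = 6 * \<rho> * avg (\<Phi> N) (\<lambda>l. \<bar>w l\<bar>)"
        using w by (simp add: av.L_add av.L_cmult)
      also have "\<dots> \<le> 6 * \<rho> * 2"
        using w1[OF elim(1)] \<open>\<rho> > 0\<close> by (intro mult_left_mono) auto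
      finally show "avg (\<Phi> N) (\<lambda>n. (y n)\<^sup>2) \<le> 12 * \<rho>" by simp
    qed (use elim(1) y in auto)
    finally show ?case by simp
  qed
qed

end

section \<open>Near-projections onto the almost periodic functions\<close>

context folner_ultra
begin

text \<open>An event that is eventual along \<open>F\<close> occurs at arbitrarily large numbers
  because \<open>F\<close> refines \<open>sequentially\<close>; this brings facts along
  \<open>F\<close> back to a genuine subsequence.\<close>

lemma choose_subsequence:
  assumes "\<And>j. eventually (good j) F"
  shows "\<exists>r::nat \<Rightarrow> nat. strict_mono r \<and> (\<forall>j. good j (r j))"
proof -
  have ex: "\<exists>N. N > n \<and> good j N" for j n
  proof -
    have "\<forall>\<^sub>F N in F. N > n"
      using eventually_gt_at_top F_le by (rule filter_leD[rotated])
    with assms[of j] have "\<forall>\<^sub>F N in F. N > n \<and> good j N"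
      by eventually_elim simp
    then show ?thesis using eventually_happens F_nontrivial by blast
  qed
  have "\<exists>r. \<forall>j. good j (r j) \<and> r j < r (Suc j)"
  proof (rule dependent_nat_choice)
    show "\<exists>x. good 0 x" using ex[of 0 0] by blast
    show "\<exists>y. good (Suc n) y \<and> x < y" for x n using ex[of x "Suc n"] by blast
  qed
  then show ?thesis by (auto simp: strict_mono_Suc_iff)
qed

end

context folner_fun
begin

section \<open>Near-minimisers of the mean square distance from \<open>a\<close>\<close>

definition sqdist :: "(nat \<Rightarrow> real) \<Rightarrow> real" where
  "sqdist P = mean (\<lambda>n. (a n - P n)\<^sup>2)"

text \<open>The slack \<open>\<rho>\<^sup>2\<close> avoids asking that the infimum be attained; such
  \<open>P\<close> act as approximate orthogonal projections of \<open>a\<close>.\<close>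

definition near :: "real \<Rightarrow> (nat \<Rightarrow> real) \<Rightarrow> bool" where
  "near \<rho> P \<longleftrightarrow> ap P \<and> sqdist P \<le> (INF P\<in>{P. ap P}. sqdist P) + \<rho>\<^sup>2"

lemma near_ap: "near \<rho> P \<Longrightarrow> ap P"
  by (simp add: near_def)

lemma sqdist_bdd_below: "bdd_below (sqdist ` {P. ap P})"
  unfolding sqdist_def by (intro bdd_belowI[of _ 0]) (auto intro!: mean.L_nonneg simp: ap_bdd)

lemma near_exists:
  assumes "\<rho> > 0" shows "\<exists>P. near \<rho> P"
proof -
  have ne: "sqdist ` {P. ap P} \<noteq> {}" using ap_const by blast
  have lt: "(INF P\<in>{P. ap P}. sqdist P) < (INF P\<in>{P. ap P}. sqdist P) + \<rho>\<^sup>2"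
    using assms by simp
  obtain y where "y \<in> sqdist ` {P. ap P}" "y < (INF P\<in>{P. ap P}. sqdist P) + \<rho>\<^sup>2"
    using cInf_lessD[OF ne lt] by blast
  then show ?thesis by (auto simp: near_def intro: less_imp_le)
qed

lemma near_le: "near \<rho> P \<Longrightarrow> ap Q \<Longrightarrow> sqdist P \<le> sqdist Q + \<rho>\<^sup>2"
  using cINF_lower[OF sqdist_bdd_below, of Q] by (simp add: near_def)

text \<open>Perturbing \<open>P\<close> by multiples of \<open>g\<close> stays almost periodic, so
  near-minimality makes a quadratic in \<open>t\<close> with constant term
  \<open>\<rho>\<^sup>2\<close> nonnegative.\<close>

lemma near_orth:
  assumes P: "near \<rho> P" and g: "ap g"
  shows "(mean (\<lambda>n. (a n - P n) * g n))\<^sup>2 \<le> \<rho>\<^sup>2 * mean (\<lambda>n. (g n)\<^sup>2)"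
proof (rule quadratic_discriminant)
  fix t :: real
  note bd [simp] = ap_bdd[OF near_ap[OF P]] ap_bdd[OF g]
  have "ap (\<lambda>n. P n + (- t) * g n)"
    by (intro ap_add ap_cmult g near_ap[OF P])
  from near_le[OF P this]
  have "sqdist P \<le> mean (\<lambda>n. ((a n - P n) + t * g n)\<^sup>2) + \<rho>\<^sup>2"
    by (simp add: sqdist_def algebra_simps)
  also have "mean (\<lambda>n. ((a n - P n) + t * g n)\<^sup>2)
      = sqdist P + 2 * t * mean (\<lambda>n. (a n - P n) * g n) + t\<^sup>2 * mean (\<lambda>n. (g n)\<^sup>2)"
    using mean.L_square_add[of "\<lambda>n. a n - P n" g t] by (simp add: sqdist_def)
  finally show "0 \<le> \<rho>\<^sup>2 + 2 * t * mean (\<lambda>n. (a n - P n) * g n) + t\<^sup>2 * mean (\<lambda>n. (g n)\<^sup>2)"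
    by simp
next
  show "0 \<le> mean (\<lambda>n. (g n)\<^sup>2)"
    using g by (intro mean.L_nonneg) (auto simp: ap_bdd)
qed

text \<open>Parallelogram law: the midpoint \<open>R\<close> is itself a competitor in the
  minimisation.\<close>

lemma near_close:
  assumes P: "near \<rho> P" and Q: "near \<sigma> Q"
  shows "mean (\<lambda>n. (P n - Q n)\<^sup>2) \<le> 2 * \<rho>\<^sup>2 + 2 * \<sigma>\<^sup>2"
proof -
  note bd [simp] = ap_bdd[OF near_ap[OF P]] ap_bdd[OF near_ap[OF Q]]
  define R where "R n = 1/2 * P n + 1/2 * Q n" for n
  have R: "ap R"
    unfolding R_def by (intro ap_add ap_cmult near_ap[OF P] near_ap[OF Q])
  note bR [simp] = ap_bdd[OF R]
  have "(\<lambda>n. (P n - Q n)\<^sup>2) = (\<lambda>n. 2 * (a n - P n)\<^sup>2 + 2 * (a n - Q n)\<^sup>2 - 4 * (a n - R n)\<^sup>2)"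
    by (rule ext) (simp add: R_def power2_eq_square field_simps)
  then have "mean (\<lambda>n. (P n - Q n)\<^sup>2) = 2 * sqdist P + 2 * sqdist Q - 4 * sqdist R"
    by (simp add: sqdist_def mean.L_diff mean.L_add mean.L_cmult)
  then show ?thesis
    using near_le[OF P R] near_le[OF Q R] by simp
qed

text \<open>The zero function is a competitor at squared distance at most 1.\<close>

lemma near_norm:
  assumes "near \<rho> P" "0 \<le> \<rho>" "\<rho> \<le> 1"
  shows "mean (\<lambda>n. (a n - P n)\<^sup>2) \<le> 2"
proof -
  have "\<bar>mean (\<lambda>n. (a n - 0)\<^sup>2)\<bar> \<le> 1"
    using a_abs by (intro mean.L_le_const) (simp add: abs_square_le_1)
  moreover have "\<rho>\<^sup>2 \<le> 1" using assms by (simp add: power_le_one)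
  ultimately show ?thesis
    using near_le[OF assms(1) ap_const[of 0]] unfolding sqdist_def by simp
qed

text \<open>The pairing is the squared norm of \<open>P\<close> plus a residual of size at most
  \<open>3 * \<rho>\<close>. The squared norm dominates \<open>(mean P)\<^sup>2\<close>, and
  near-orthogonality to constants puts \<open>mean P\<close> within \<open>\<rho>\<close> of
  \<open>mean a\<close>, which costs \<open>2 * \<rho>\<close>.\<close>

lemma near_projection:
  assumes P: "near \<rho> P" and \<rho>: "0 \<le> \<rho>" "\<rho> \<le> 1"
  shows "mean (\<lambda>n. P n * a n) \<ge> (mean a)\<^sup>2 - 5 * \<rho>"
proof -
  note bd [simp] = ap_bdd[OF near_ap[OF P]]
  have bda: "bdd a" using a_abs by (rule bddI)
  have a1: "\<bar>mean a\<bar> \<le> 1" by (intro mean.L_le_const a_abs)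
  have split: "mean (\<lambda>n. P n * a n) = mean (\<lambda>n. (P n)\<^sup>2) + mean (\<lambda>n. (a n - P n) * P n)"
    by (subst mean.L_add[symmetric]) (auto simp: algebra_simps power2_eq_square)
  have "mean (\<lambda>n. (P n)\<^sup>2) \<le> mean (\<lambda>n. 2 * (a n)\<^sup>2 + 2 * (a n - P n)\<^sup>2)"
  proof (rule mean.L_mono)
    fix n
    have "2 * (a n)\<^sup>2 + 2 * (a n - P n)\<^sup>2 - (P n)\<^sup>2 = (2 * a n - P n)\<^sup>2"
      by (simp add: power2_eq_square algebra_simps)
    then show "(P n)\<^sup>2 \<le> 2 * (a n)\<^sup>2 + 2 * (a n - P n)\<^sup>2"
      using zero_le_power2[of "2 * a n - P n"] by linarith
  qed auto
  also have "\<dots> = 2 * mean (\<lambda>n. (a n)\<^sup>2) + 2 * mean (\<lambda>n. (a n - P n)\<^sup>2)"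
    by (simp add: mean.L_add mean.L_cmult)
  also have "\<dots> \<le> 2 * 1 + 2 * 2"
  proof -
    have "\<bar>mean (\<lambda>n. (a n)\<^sup>2)\<bar> \<le> 1"
      using a_abs by (intro mean.L_le_const) (simp add: abs_square_le_1)
    then show ?thesis using near_norm[OF P \<rho>] by linarith
  qed
  \<comment> \<open>The bound 6 is relaxed to a perfect square.\<close>
  finally have "mean (\<lambda>n. (P n)\<^sup>2) \<le> 9" by simp
  then have "(mean (\<lambda>n. (a n - P n) * P n))\<^sup>2 \<le> \<rho>\<^sup>2 * 9"
    by (intro order_trans[OF near_orth[OF P near_ap[OF P]]] mult_left_mono) auto
  also have "\<dots> = (3 * \<rho>)\<^sup>2" by (simp add: power_mult_distrib)
  finally have 1: "\<bar>mean (\<lambda>n. (a n - P n) * P n)\<bar> \<le> 3 * \<rho>"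
    using \<rho> by (intro abs_le_of_square_le) auto
  have "(mean (\<lambda>n. (a n - P n) * 1))\<^sup>2 \<le> \<rho>\<^sup>2 * mean (\<lambda>n. 1\<^sup>2)"
    by (rule near_orth[OF P ap_const])
  then have "\<bar>mean a - mean P\<bar> \<le> \<rho>"
    using \<rho> by (simp add: abs_le_square_iff[symmetric] mean.L_diff mean.L_const bda)
  then have "\<bar>mean a * (mean a - mean P)\<bar> \<le> 1 * \<rho>"
    unfolding abs_mult using a1 by (intro mult_mono) auto
  moreover have "(mean P)\<^sup>2 \<ge> (mean a)\<^sup>2 - 2 * (mean a * (mean a - mean P))"
    using zero_le_power2[of "mean P - mean a"] by (simp add: power2_eq_square algebra_simps)
  ultimately have "(mean P)\<^sup>2 \<ge> (mean a)\<^sup>2 - 2 * \<rho>" by linarith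
  then have "mean (\<lambda>n. (P n)\<^sup>2) \<ge> (mean a)\<^sup>2 - 2 * \<rho>"
    using mean.L_square_le[of P] by simp
  then show ?thesis using 1 split by linarith
qed

text \<open>Expanding the square and exchanging the mean over \<open>k\<close> with the finite
  averages gives the quadratic form with kernel \<open>corr\<close>. The shift \<open>m\<close> is
  absorbed by the shift invariance of \<open>corr2\<close>.\<close>

lemma near_residual_small:
  assumes P: "near \<rho> P" and \<rho>: "0 < \<rho>" "\<rho> \<le> 1"
  shows "\<forall>\<^sub>F N in F.
    (mean (\<lambda>k. (avg (\<Phi> N) (\<lambda>n. (a (n + m) - P (n + m)) * a (n + k)))\<^sup>2))\<^sup>2 \<le> 36 * \<rho>"
proof -
  note bP [simp] = ap_bdd[OF near_ap[OF P]]
  define w where "w n = a (n + m) - P (n + m)" for n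
  have bP' [simp]: "bdd (\<lambda>n. P (n + m))" by (rule bdd_compose) simp
  have bw [simp]: "bdd w" unfolding w_def by simp
  have w2: "mean (\<lambda>n. (w n)\<^sup>2) \<le> 2"
    using mean_shift[of "\<lambda>n. (a n - P n)\<^sup>2" m] near_norm[OF P] \<rho> by (simp add: w_def)
  have orth: "\<bar>mean (\<lambda>n. w n * corr2 t n)\<bar> \<le> \<rho>" for t
  proof -
    have "mean (\<lambda>n. w n * corr2 t n) = mean (\<lambda>n. (a n - P n) * corr2 (t + m) n)"
      using mean_shift[of "\<lambda>n. (a n - P n) * corr2 (t + m) n" m] by (simp add: w_def corr2_shift)
    then have "(mean (\<lambda>n. w n * corr2 t n))\<^sup>2 \<le> \<rho>\<^sup>2 * mean (\<lambda>n. (corr2 (t + m) n)\<^sup>2)"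
      using near_orth[OF P ap_corr2] by simp
    also have "\<dots> \<le> \<rho>\<^sup>2 * 1"
    proof (rule mult_left_mono)
      have "\<bar>mean (\<lambda>n. (corr2 (t + m) n)\<^sup>2)\<bar> \<le> 1"
        unfolding power2_eq_square by (intro mean.L_le_const abs_mult_le_1 corr2_abs)
      then show "mean (\<lambda>n. (corr2 (t + m) n)\<^sup>2) \<le> 1" by simp
    qed simp
    finally show ?thesis using \<rho> by (simp add: abs_le_square_iff[symmetric])
  qed
  have "mean (\<lambda>k. (avg (\<Phi> N) (\<lambda>n. w n * a (n + k)))\<^sup>2)
      = avg (\<Phi> N) (\<lambda>n. avg (\<Phi> N) (\<lambda>l. w n * w l * corr n l))" for N
  proof -
    have "(\<lambda>k. (avg (\<Phi> N) (\<lambda>n. w n * a (n + k)))\<^sup>2)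
        = (\<lambda>k. avg (\<Phi> N) (\<lambda>n. avg (\<Phi> N) (\<lambda>l. (w n * w l) * (a (n + k) * a (l + k)))))"
      unfolding power2_eq_square avg_mult_avg by (simp add: mult_ac)
    then show ?thesis by (simp add: mean.L_avg mean.L_cmult corr_def)
  qed
  then show ?thesis
    using corr_form_small[OF bw w2 \<rho>(1) orth] unfolding w_def by simp
qed

text \<open>
  Since \<open>Q j\<close> is only nearly optimal, its residual cannot be negligible for all shifts \<open>m\<close> at once; hence
  the optimality of \<open>Q j\<close> improves with \<open>j\<close>, while \<open>P\<close> stays fixed and remains close to \<open>Q j\<close> in mean square.
\<close>

lemma exists_scales:
  assumes \<rho>: "0 < \<rho>" "\<rho> \<le> 1"
  shows "\<exists>P r k Q. ap P \<and> strict_mono (r :: nat \<Rightarrow> nat) \<and> (\<forall>J::nat. k J \<ge> J) \<and>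
    (\<forall>J. \<forall>j<J. avg (\<Phi> (r j)) (\<lambda>i. P (i + k J) * a (i + k J)) \<ge> (mean a)\<^sup>2 - 7 * \<rho>) \<and>
    (\<forall>J. \<forall>j<J. \<forall>m\<le>j.
      \<bar>avg (\<Phi> (r j)) (\<lambda>n. (a (n + m) - Q j (n + m)) * a (n + k J))\<bar> \<le> (1/2) ^ j) \<and>
    (\<forall>j. \<forall>m\<le>j. avg (\<Phi> (r j)) (\<lambda>n. (Q j (n + m) - P (n + m))\<^sup>2) \<le> 9 * \<rho>\<^sup>2) \<and>
    (\<forall>j. bdd (Q j))"
proof -
  obtain P where P: "near \<rho> P" using near_exists \<rho> by blast
  note bP [simp] = ap_bdd[OF near_ap[OF P]]
  have bPc [simp]: "bdd (\<lambda>n. P (f n))" for f :: "nat \<Rightarrow> nat" by (rule bdd_compose) simp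
  have "bdd (\<lambda>n. P n * a n)" by simp
  then obtain C where C: "C > 0" "\<And>n. \<bar>P n * a n\<bar> \<le> C" using bddE by blast
  define \<mu> where "\<mu> = mean (\<lambda>n. P n * a n)"
  have \<mu>: "\<mu> \<ge> (mean a)\<^sup>2 - 5 * \<rho>" unfolding \<mu>_def using near_projection[OF P] \<rho> by simp
  have \<mu>C: "\<bar>\<mu>\<bar> \<le> C" unfolding \<mu>_def by (intro mean.L_le_const C)
  define Z where "Z N k = avg (\<Phi> N) (\<lambda>i. P (i + k) * a (i + k))" for N k
  have ZC: "\<bar>Z N k\<bar> \<le> C" for N k unfolding Z_def by (intro av.L_le_const C)
  have bZ [simp]: "bdd (Z N)" for N using ZC by (rule bddI)
  have meanZ: "mean (Z N) = \<mu>" for N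
  proof -
    have "mean (\<lambda>k. P (i + k) * a (i + k)) = \<mu>" for i
      unfolding \<mu>_def by (rule mean_shift_left) simp
    then show ?thesis unfolding Z_def by (subst mean.L_avg) (auto simp: av.L_const)
  qed
  \<comment> \<open>\<open>\<delta>\<close> is the mean of the normalised excess of
    \<open>Z N\<close> over \<open>\<mu> - \<rho>\<close>, a function at most 1. All deviations
    together are allowed mean at most \<open>\<delta> / 2\<close>.\<close>
  define \<delta> where "\<delta> = \<rho> / (2 * C + \<rho>)"
  have \<delta>: "\<delta> > 0" unfolding \<delta>_def using C \<rho> by simp
  \<comment> \<open>These tolerances sum to \<open>\<rho>\<close>, the total loss permitted across
    the scales.\<close>
  define \<tau> where "\<tau> j = (\<rho> * (1/2) ^ (Suc j))" for j
  \<comment> \<open>Chebyshev budgets: divided by the squared tolerances \<open>\<tau> j\<close> and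
    \<open>(1/2) ^ j\<close>, each kind of deviation has mean at most
    \<open>\<delta> / 8 * (1/2) ^ j\<close>. The divisor \<open>Suc j\<close> in
    \<open>\<beta> j\<close> counts the shifts \<open>m \<le> j\<close>.\<close>
  define \<eta> where "\<eta> j = \<delta> / 8 * (1/2) ^ j * (\<tau> j)\<^sup>2" for j
  define \<beta> where "\<beta> j = \<delta> / 8 * (1/2) ^ j / real (Suc j) * ((1/2) ^ j)\<^sup>2" for j
  have \<tau>0: "\<tau> j > 0" for j unfolding \<tau>_def using \<rho> by simp
  have \<eta>0: "\<eta> j > 0" for j unfolding \<eta>_def using \<delta> \<tau>0[of j] by simp
  have \<beta>0: "\<beta> j > 0" for j unfolding \<beta>_def using \<delta> by simp
  \<comment> \<open>The residual estimate bounds the square of a mean by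
    \<open>36 * \<sigma> j\<close>, hence the mean by \<open>\<beta> j\<close>; the cap
    \<open>\<rho>\<close> keeps \<open>Q j\<close> close to \<open>P\<close>.\<close>
  define \<sigma> where "\<sigma> j = min \<rho> ((\<beta> j)\<^sup>2 / 36)" for j
  have \<sigma>: "0 < \<sigma> j" "\<sigma> j \<le> \<rho>" "36 * \<sigma> j \<le> (\<beta> j)\<^sup>2" for j
    unfolding \<sigma>_def using \<rho> \<beta>0[of j] by auto
  have "\<exists>Q. \<forall>j. near (\<sigma> j) (Q j)" by (intro choice allI near_exists \<sigma>)
  then obtain Q where Q: "\<And>j. near (\<sigma> j) (Q j)" by blast
  have bQ [simp]: "bdd (Q j)" for j by (rule ap_bdd[OF near_ap[OF Q]])
  have bQc [simp]: "bdd (\<lambda>n. Q j (f n))" for j and f :: "nat \<Rightarrow> nat" by (rule bdd_compose) simp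
  have "\<exists>G. eventually G F \<and> (\<forall>N N'. G N \<longrightarrow> G N' \<longrightarrow> mean (\<lambda>x. (Z N x - Z N' x)\<^sup>2) \<le> \<eta> j)" for j
  proof -
    have inv: "mean (\<lambda>x. (P (i + m + x) * a (i + m + x)) * (P (l + m + x) * a (l + m + x)))
      = mean (\<lambda>x. (P (i + x) * a (i + x)) * (P (l + x) * a (l + x)))" for i l m
      using mean_shift_left[of "\<lambda>x. (P (i + x) * a (i + x)) * (P (l + x) * a (l + x))" m]
      by (simp add: add.assoc)
    define e where "e i k = P (i + k) * a (i + k)" for i k
    have "\<bar>e i k\<bar> \<le> C" for i k unfolding e_def by (rule C)
    moreover have "mean (\<lambda>x. e (i + m) x * e (l + m) x) = mean (\<lambda>x. e i x * e l x)" for i l m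
      unfolding e_def by (rule inv)
    ultimately show ?thesis
      using mean_ergodic[of mean e C, OF mean.pos_mean_axioms _ _ \<eta>0[of j]]
      unfolding Z_def e_def by blast
  qed
  then have "\<exists>G. \<forall>j. eventually (G j) F \<and>
      (\<forall>N N'. G j N \<longrightarrow> G j N' \<longrightarrow> mean (\<lambda>x. (Z N x - Z N' x)\<^sup>2) \<le> \<eta> j)"
    by (intro choice allI)
  then obtain G where G: "\<And>j. eventually (G j) F"
    and GZ: "\<And>j N N'. G j N \<Longrightarrow> G j N' \<Longrightarrow> mean (\<lambda>x. (Z N x - Z N' x)\<^sup>2) \<le> \<eta> j"
    by blast
  define U where "U N j m k = avg (\<Phi> N) (\<lambda>n. (a (n + m) - Q j (n + m)) * a (n + k))" for N j m k
  have bU [simp]: "bdd (U N j m)" for N j m unfolding U_def by (intro bdd_avg) simp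
  have evU: "\<forall>\<^sub>F N in F. mean (\<lambda>k. (U N j m k)\<^sup>2) \<le> \<beta> j" for j m
  proof -
    have "\<sigma> j \<le> 1" using \<sigma>(2)[of j] \<rho> by simp
    from near_residual_small[OF Q \<sigma>(1) this, of m]
    show ?thesis
    proof eventually_elim
      case (elim N)
      have "(mean (\<lambda>k. (U N j m k)\<^sup>2))\<^sup>2 \<le> (\<beta> j)\<^sup>2"
        unfolding U_def by (rule order_trans[OF elim \<sigma>(3)])
      then show ?case by (rule power2_le_imp_le[OF _ less_imp_le[OF \<beta>0]])
    qed
  qed
  have evV: "\<forall>\<^sub>F N in F. avg (\<Phi> N) (\<lambda>n. (Q j (n + m) - P (n + m))\<^sup>2) \<le> 9 * \<rho>\<^sup>2" for j m
  proof -
    have "mean (\<lambda>n. (Q j (n + m) - P (n + m))\<^sup>2) = mean (\<lambda>n. (Q j n - P n)\<^sup>2)"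
      by (rule mean_shift[of "\<lambda>n. (Q j n - P n)\<^sup>2"]) simp
    also have "\<dots> \<le> 2 * (\<sigma> j)\<^sup>2 + 2 * \<rho>\<^sup>2" by (rule near_close[OF Q P])
    also have "\<dots> < 9 * \<rho>\<^sup>2"
    proof -
      have "(\<sigma> j)\<^sup>2 \<le> \<rho>\<^sup>2" using \<sigma>[of j] by (intro power_mono) auto
      moreover have "\<rho>\<^sup>2 > 0" using \<rho> by simp
      ultimately show ?thesis by linarith
    qed
    finally have "mean (\<lambda>n. (Q j (n + m) - P (n + m))\<^sup>2) < 9 * \<rho>\<^sup>2" .
    then have "\<forall>\<^sub>F N in F. avg (\<Phi> N) (\<lambda>n. (Q j (n + m) - P (n + m))\<^sup>2) < 9 * \<rho>\<^sup>2"
      by (intro order_tendstoD(2)[OF mean_tendsto]) auto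
    then show ?thesis by eventually_elim simp
  qed
  \<comment> \<open>\<open>G i\<close> is demanded for all \<open>i \<le> j\<close> so that the
    consecutive scales \<open>r j\<close> and \<open>r (Suc j)\<close> both satisfy
    \<open>G j\<close>.\<close>
  define good where "good j N \<longleftrightarrow> (\<forall>i\<in>{..j}. G i N) \<and> (\<forall>m\<in>{..j}. mean (\<lambda>k. (U N j m k)\<^sup>2) \<le> \<beta> j)
    \<and> (\<forall>m\<in>{..j}. avg (\<Phi> N) (\<lambda>n. (Q j (n + m) - P (n + m))\<^sup>2) \<le> 9 * \<rho>\<^sup>2)" for j N
  have "eventually (good j) F" for j
    unfolding good_def by (intro eventually_conj eventually_ball_finite ballI G evU evV) auto
  then obtain r where r: "strict_mono r" and good: "\<And>j. good j (r j)"
    using choose_subsequence[of good] by blast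
  \<comment> \<open>\<open>b j k \<le> 1\<close> forces every deviation at stage \<open>j\<close>
    within its tolerance.\<close>
  define b where "b j k = (Z (r j) k - Z (r (Suc j)) k)\<^sup>2 / (\<tau> j)\<^sup>2
      + (\<Sum>m\<le>j. (U (r j) j m k)\<^sup>2 / ((1/2) ^ j)\<^sup>2)" for j k
  have bb [simp]: "bdd (b j)" for j unfolding b_def by simp
  have meanb: "mean (b j) \<le> \<delta> / 4 * (1/2) ^ j" for j
  proof -
    have "G j (r j)" "G j (r (Suc j))" using good[of j] good[of "Suc j"] by (auto simp: good_def)
    then have "mean (\<lambda>k. (Z (r j) k - Z (r (Suc j)) k)\<^sup>2) / (\<tau> j)\<^sup>2 \<le> \<eta> j / (\<tau> j)\<^sup>2"
      by (intro divide_right_mono GZ) auto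
    also have "\<dots> = \<delta> / 8 * (1/2) ^ j"
      using \<tau>0[of j] by (simp add: \<eta>_def)
    finally have 1: "mean (\<lambda>k. (Z (r j) k - Z (r (Suc j)) k)\<^sup>2 / (\<tau> j)\<^sup>2) \<le> \<delta> / 8 * (1/2) ^ j"
      by (simp add: mean.L_divide)
    have "mean (\<lambda>k. \<Sum>m\<le>j. (U (r j) j m k)\<^sup>2 / ((1/2) ^ j)\<^sup>2)
        = (\<Sum>m\<le>j. mean (\<lambda>k. (U (r j) j m k)\<^sup>2) / ((1/2) ^ j)\<^sup>2)"
      by (subst mean.L_sum) (auto simp: mean.L_divide)
    also have "\<dots> \<le> (\<Sum>m\<le>j. \<beta> j / ((1/2) ^ j)\<^sup>2)"
      using good[of j] by (intro sum_mono divide_right_mono) (auto simp: good_def)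
    also have "\<dots> = \<delta> / 8 * (1/2) ^ j" by (simp add: \<beta>_def del: of_nat_Suc)
    finally have 2: "mean (\<lambda>k. \<Sum>m\<le>j. (U (r j) j m k)\<^sup>2 / ((1/2) ^ j)\<^sup>2) \<le> \<delta> / 8 * (1/2) ^ j" .
    have "mean (b j) = mean (\<lambda>k. (Z (r j) k - Z (r (Suc j)) k)\<^sup>2 / (\<tau> j)\<^sup>2)
        + mean (\<lambda>k. \<Sum>m\<le>j. (U (r j) j m k)\<^sup>2 / ((1/2) ^ j)\<^sup>2)"
      unfolding b_def by (subst mean.L_add) auto
    then show ?thesis using 1 2 by simp
  qed
  \<comment> \<open>First-moment argument: without such a \<open>k\<close>, the function
    \<open>f\<close> would be nonpositive from \<open>J\<close> on, so its mean would be at most 0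
    by shift invariance; the budgets give at least \<open>\<delta> / 2\<close>.\<close>
  have "\<exists>k\<ge>J. Z (r 0) k \<ge> \<mu> - \<rho> \<and> (\<forall>j<J. b j k \<le> 1)" for J
  proof (rule ccontr)
    assume neg: "\<not> ?thesis"
    define g where "g k = (Z (r 0) k - (\<mu> - \<rho>)) / (2 * C + \<rho>)" for k
    define f where "f k = g k - (\<Sum>j<J. b j k)" for k
    have bg [simp]: "bdd g" unfolding g_def by simp
    have bf [simp]: "bdd f" unfolding f_def by simp
    have b0: "b j k \<ge> 0" for j k unfolding b_def by (intro add_nonneg_nonneg sum_nonneg) auto
    have "f k \<le> 0" if "k \<ge> J" for k
    proof (cases "Z (r 0) k \<ge> \<mu> - \<rho>")
      case True
      then have "\<not> (\<forall>j<J. b j k \<le> 1)" using neg that by blast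
      then obtain j where j: "j < J" "b j k > 1" by (auto simp: not_le)
      have "b j k \<le> (\<Sum>j<J. b j k)"
        using j b0 by (intro member_le_sum) auto
      moreover have "g k \<le> 1"
        unfolding g_def using ZC[of "r 0" k] \<mu>C C(1) \<rho> by (simp add: divide_simps)
      ultimately show ?thesis using j unfolding f_def by simp
    next
      case False
      then have "g k \<le> 0" unfolding g_def using C(1) \<rho> by (simp add: divide_simps)
      then show ?thesis unfolding f_def using sum_nonneg[of "{..<J}" "\<lambda>j. b j k"] b0 by simp
    qed
    then have "mean (\<lambda>k. f (k + J)) \<le> mean (\<lambda>k. 0)"
      by (intro mean.L_mono) (auto intro: bdd_compose)
    then have le: "mean f \<le> 0" by (simp add: mean_shift mean.L_const)
    have "mean g = \<delta>"
      unfolding g_def \<delta>_def by (simp add: mean.L_divide mean.L_diff mean.L_const meanZ)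
    then have "mean f = \<delta> - (\<Sum>j<J. mean (b j))"
      unfolding f_def by (simp add: mean.L_diff mean.L_sum)
    moreover have "(\<Sum>j<J. mean (b j)) \<le> (\<Sum>j<J. \<delta> / 4 * (1/2) ^ j)"
      by (intro sum_mono meanb)
    moreover have "(\<Sum>j<J. (1/2) ^ j) \<le> (2::real)"
      by (simp add: geometric_sum)
    then have "(\<Sum>j<J. \<delta> / 4 * (1/2) ^ j) \<le> \<delta> / 4 * 2"
      using \<delta> by (subst sum_distrib_left[symmetric]) (intro mult_left_mono, auto)
    ultimately show False using le \<delta> by simp
  qed
  then have "\<exists>k. \<forall>J. k J \<ge> J \<and> Z (r 0) (k J) \<ge> \<mu> - \<rho> \<and> (\<forall>j<J. b j (k J) \<le> 1)"
    by (intro choice allI)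
  then obtain k where k: "\<And>J. k J \<ge> J" "\<And>J. Z (r 0) (k J) \<ge> \<mu> - \<rho>"
    "\<And>j J. j < J \<Longrightarrow> b j (k J) \<le> 1" by blast
  have Ustep: "\<bar>U (r j) j m (k J)\<bar> \<le> (1/2) ^ j" if "m \<le> j" "j < J" for j m J
  proof -
    have "(U (r j) j m (k J))\<^sup>2 / ((1/2) ^ j)\<^sup>2 \<le> (\<Sum>m\<le>j. (U (r j) j m (k J))\<^sup>2 / ((1/2) ^ j)\<^sup>2)"
      using that by (intro member_le_sum[of m "{..j}" "\<lambda>m. (U (r j) j m (k J))\<^sup>2 / ((1/2) ^ j)\<^sup>2"]) auto
    also have "\<dots> \<le> b j (k J)" unfolding b_def by simp
    also have "\<dots> \<le> 1" using k(3) that by simp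
    finally have "(U (r j) j m (k J))\<^sup>2 \<le> ((1/2) ^ j)\<^sup>2" by (simp add: divide_simps)
    then show ?thesis by (simp add: abs_le_square_iff[symmetric])
  qed
  have Zstep: "\<bar>Z (r j) (k J) - Z (r (Suc j)) (k J)\<bar> \<le> \<tau> j" if "j < J" for j J
  proof -
    have "(Z (r j) (k J) - Z (r (Suc j)) (k J))\<^sup>2 / (\<tau> j)\<^sup>2 \<le> b j (k J)"
      unfolding b_def by (simp add: sum_nonneg)
    also have "\<dots> \<le> 1" using k(3) that by simp
    finally have "(Z (r j) (k J) - Z (r (Suc j)) (k J))\<^sup>2 \<le> (\<tau> j)\<^sup>2"
      using \<tau>0[of j] by (simp add: divide_simps)
    then show ?thesis using \<tau>0[of j] by (simp add: abs_le_square_iff[symmetric])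
  qed
  \<comment> \<open>The term \<open>\<rho> * (1/2) ^ j\<close> is the tolerance still unspent after
    \<open>j\<close> steps.\<close>
  have Zlow: "Z (r j) (k J) \<ge> \<mu> - 2 * \<rho> + \<rho> * (1/2) ^ j" if "j \<le> J" for j J
    using that
  proof (induction j)
    case 0
    then show ?case using k(2)[of J] by simp
  next
    case (Suc j)
    have "\<rho> * (1/2) ^ Suc j = \<rho> * (1/2) ^ j - \<tau> j" by (simp add: \<tau>_def)
    then show ?case using Zstep[of j J] Suc by linarith
  qed
  show ?thesis
  proof (rule exI[of _ P], rule exI[of _ r], rule exI[of _ k], rule exI[of _ Q], intro conjI allI impI)
    fix J j :: nat assume "j < J"
    moreover have "\<rho> * (1/2) ^ j \<ge> 0" using \<rho> by simp
    ultimately show "avg (\<Phi> (r j)) (\<lambda>i. P (i + k J) * a (i + k J)) \<ge> (mean a)\<^sup>2 - 7 * \<rho>"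
      using Zlow[of j J] \<mu> unfolding Z_def by linarith
  next
    fix J j m :: nat assume "j < J" "m \<le> j"
    then show "\<bar>avg (\<Phi> (r j)) (\<lambda>n. (a (n + m) - Q j (n + m)) * a (n + k J))\<bar> \<le> (1/2) ^ j"
      using Ustep[of m j J] unfolding U_def by blast
  next
    fix j m :: nat assume "m \<le> j"
    then show "avg (\<Phi> (r j)) (\<lambda>n. (Q j (n + m) - P (n + m))\<^sup>2) \<le> 9 * \<rho>\<^sup>2"
      using good[of j] by (auto simp: good_def)
  qed (use near_ap[OF P] r k in auto)
qed

end

section \<open>Construction of the ultrafilter\<close>

lemma folner_subseq:
  assumes "folner \<Phi>" "strict_mono r" shows "folner (\<Phi> \<circ> r)"
  unfolding folner_def
proof (intro conjI allI)
  fix m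
  show "(\<lambda>N. real (card ((((\<lambda>n. n + m) ` (\<Phi> \<circ> r) N) - (\<Phi> \<circ> r) N) \<union> ((\<Phi> \<circ> r) N - ((\<lambda>n. n + m) ` (\<Phi> \<circ> r) N))))
                      / real (card ((\<Phi> \<circ> r) N))) \<longlonglongrightarrow> 0"
    using LIMSEQ_subseq_LIMSEQ[OF _ assms(2)] assms(1) unfolding folner_def o_def by blast
qed (use assms(1) in \<open>auto simp: folner_def\<close>)

lemma dens_seq_avg: "folner \<Phi> \<Longrightarrow> dens_seq \<Phi> E N = avg (\<Phi> N) (\<lambda>n. of_bool (n \<in> E))"
  by (simp add: dens_seq_def avg_def folner_def Int_commute)

lemma ultrafilter_nat_of_filter:
  assumes "ultra p" shows "ultrafilter_nat {X. \<forall>\<^sub>F x in p. x \<in> X}"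
  using assms unfolding ultrafilter_nat_def ultra_def
  by (auto simp: trivial_limit_def elim: eventually_mono intro: eventually_conj)

lemma nonprincipal_of_filter:
  assumes "ultra p" "p \<le> sequentially" shows "nonprincipal {X. \<forall>\<^sub>F x in p. x \<in> X}"
  unfolding nonprincipal_def
proof (intro allI notI)
  fix n assume "{n} \<in> {X. \<forall>\<^sub>F x in p. x \<in> X}"
  moreover have "\<forall>\<^sub>F x in p. x > n"
    by (rule filter_leD[OF assms(2) eventually_gt_at_top])
  ultimately have "\<forall>\<^sub>F x in p. x > n \<and> x = n"
    by (auto intro: eventually_conj)
  then show False using eventually_happens ultra_nontrivial[OF assms(1)] by force
qed

lemma ulim_eq:
  assumes "ultra p" and f: "(f \<longlongrightarrow> l) p"
  shows "ulim {X. \<forall>\<^sub>F x in p. x \<in> X} f = l"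
proof -
  have iff: "(\<forall>\<delta>>0. {m. \<bar>f m - x\<bar> < \<delta>} \<in> {X. \<forall>\<^sub>F x in p. x \<in> X}) \<longleftrightarrow> (f \<longlongrightarrow> x) p" for x
    by (simp add: tendsto_iff dist_real_def)
  show ?thesis
    unfolding ulim_def iff
    using f tendsto_unique[OF ultra_nontrivial[OF assms(1)]] by blast
qed

theorem theorem2p6:
  fixes A :: "nat set" and \<Phi> :: "nat \<Rightarrow> nat set" and \<epsilon> :: real
  assumes "folner \<Phi>" and "dens_exists \<Phi> A" and "\<epsilon> > 0"
  shows "\<exists>r p. strict_mono r \<and> folner (\<Phi> \<circ> r) \<and>
           ultrafilter_nat p \<and> nonprincipal p \<and>
           (\<forall>m. dens_exists (\<Phi> \<circ> r) (shift_set A m \<inter> shift_uf A p)) \<and>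
           ulim p (\<lambda>m. dens (\<Phi> \<circ> r) (shift_set A m \<inter> shift_uf A p))
             \<ge> (dens (\<Phi> \<circ> r) A)\<^sup>2 - \<epsilon>"
proof -
  obtain F where F: "ultra F" "F \<le> (sequentially :: nat filter)"
    using ultra_below[of "sequentially :: nat filter"] by auto
  define a :: "nat \<Rightarrow> real" where "a n = of_bool (n \<in> A)" for n
  interpret folner_fun \<Phi> F a
    by unfold_locales (use assms F in \<open>auto simp: a_def\<close>)
  define d where "d = dens \<Phi> A"
  have d: "dens_seq \<Phi> A \<longlonglongrightarrow> d"
    using assms(2) by (simp add: d_def dens_def dens_exists_def convergent_LIMSEQ_iff)
  then have "((\<lambda>N. avg (\<Phi> N) a) \<longlongrightarrow> d) F"
    unfolding dens_seq_avg[OF assms(1), abs_def] a_def[abs_def] by (rule tendsto_F)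
  then have mean_a: "mean a = d" by (rule meanI)
  \<comment> \<open>The final loss is \<open>11 * \<rho>\<close>: 7 from the structured part, 3 from
    replacing \<open>Q j\<close> by \<open>P\<close>, and 1 from replacing a translate of
    \<open>P\<close> by its limit.\<close>
  define \<rho> where "\<rho> = min 1 (\<epsilon> / 20)"
  have \<rho>: "0 < \<rho>" "\<rho> \<le> 1" "11 * \<rho> \<le> \<epsilon>" using assms(3) by (auto simp: \<rho>_def min_def)
  obtain P r k Q where P: "ap P" and r: "strict_mono (r :: nat \<Rightarrow> nat)" and k: "\<forall>J::nat. k J \<ge> J"
    and PZ: "\<forall>J. \<forall>j<J. avg (\<Phi> (r j)) (\<lambda>i. P (i + k J) * a (i + k J)) \<ge> (mean a)\<^sup>2 - 7 * \<rho>"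
    and QU: "\<forall>J. \<forall>j<J. \<forall>m\<le>j.
      \<bar>avg (\<Phi> (r j)) (\<lambda>n. (a (n + m) - Q j (n + m)) * a (n + k J))\<bar> \<le> (1/2) ^ j"
    and QP: "\<forall>j. \<forall>m\<le>j. avg (\<Phi> (r j)) (\<lambda>n. (Q j (n + m) - P (n + m))\<^sup>2) \<le> 9 * \<rho>\<^sup>2"
    and bQ: "\<forall>j. bdd (Q j)"
    using exists_scales[OF \<rho>(1,2)] by (elim exE conjE)
  have "filtermap k sequentially \<noteq> bot" by (simp add: filtermap_bot_iff)
  \<comment> \<open>Whatever holds at \<open>k J\<close> for all large \<open>J\<close> holds
    \<open>p\<close>-eventually; since \<open>k J \<ge> J\<close>, this also makes \<open>p\<close>
    nonprincipal.\<close>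
  then obtain p where p: "ultra p" "p \<le> filtermap k sequentially"
    using ultra_below by blast
  note p_nt = ultra_nontrivial[OF p(1)]
  have ev_p: "eventually R p" if "\<And>J. j < J \<Longrightarrow> R (k J)" for R j
    by (rule filter_leD[OF p(2)])
      (use that in \<open>auto simp: eventually_filtermap intro: eventually_mono[OF eventually_gt_at_top[of j]]\<close>)
  have p_seq: "p \<le> sequentially"
  proof (rule filter_leI)
    fix R :: "nat \<Rightarrow> bool" assume "eventually R sequentially"
    then obtain j where "\<And>n. n \<ge> j \<Longrightarrow> R n" by (auto simp: eventually_sequentially)
    then show "eventually R p" using k by (intro ev_p[of j]) (meson less_imp_le order_trans)
  qed
  \<comment> \<open>The indicator of \<open>A - p\<close>, which is the pointwise limit of the
    translates of \<open>a\<close> along \<open>p\<close>.\<close>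
  define h :: "nat \<Rightarrow> real" where "h n = of_bool (\<forall>\<^sub>F x in p. x + n \<in> A)" for n
  have h: "((\<lambda>x. a (n + x)) \<longlongrightarrow> h n) p" for n
  proof (rule tendsto_eventually)
    show "\<forall>\<^sub>F x in p. a (n + x) = h n"
    proof (cases "\<forall>\<^sub>F x in p. x + n \<in> A")
      case True
      then show ?thesis by (auto simp: a_def h_def add.commute elim: eventually_mono)
    next
      case False
      with ultra_not_eventually[OF p(1) False]
      show ?thesis by (auto simp: a_def h_def add.commute elim: eventually_mono)
    qed
  qed
  have h1: "\<bar>h n\<bar> \<le> 1" for n by (simp add: h_def)
  have bh: "bdd h" using h1 by (rule bddI)
  \<comment> \<open>The same limit \<open>g\<close> serves twice: pointwise when the shifts
    \<open>k J\<close> tend to \<open>p\<close>, and uniformly when the outer variable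
    \<open>m\<close> does. This is what reconciles the two limits.\<close>
  obtain g where g: "\<And>\<eta>. \<eta> > 0 \<Longrightarrow> \<forall>\<^sub>F m in p. \<forall>n. \<bar>P (n + m) - g n\<bar> \<le> \<eta>"
    using P p(1) unfolding ap_def by blast
  have gt: "((\<lambda>m. P (n + m)) \<longlongrightarrow> g n) p" for n
  proof (rule tendstoI)
    fix e :: real assume "e > 0"
    then have "e / 2 > 0" by simp
    from g[OF this] show "\<forall>\<^sub>F m in p. dist (P (n + m)) (g n) < e"
    proof eventually_elim
      case (elim m)
      have "\<bar>P (n + m) - g n\<bar> \<le> e / 2" using elim by blast
      then show ?case unfolding dist_real_def using \<open>e > 0\<close> by linarith
    qed
  qed
  have bP: "bdd (\<lambda>n. P (f n))" for f :: "nat \<Rightarrow> nat"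
    using ap_bdd[OF P] by (rule bdd_compose)
  have bg: "bdd g"
  proof -
    obtain C where C: "\<And>n. \<bar>P n\<bar> \<le> C" using ap_bdd[OF P] by (auto simp: bdd_def)
    have "\<bar>g n\<bar> \<le> C" for n
      by (rule tendsto_upperbound[OF tendsto_rabs[OF gt] _ p_nt]) (simp add: C)
    then show ?thesis by (rule bddI)
  qed
  have gh: "avg (\<Phi> (r j)) (\<lambda>n. g n * h n) \<ge> d\<^sup>2 - 7 * \<rho>" for j
  proof (rule tendsto_lowerbound[OF _ _ p_nt])
    show "((\<lambda>x. avg (\<Phi> (r j)) (\<lambda>n. P (n + x) * a (n + x))) \<longlongrightarrow> avg (\<Phi> (r j)) (\<lambda>n. g n * h n)) p"
      by (intro tendsto_avg tendsto_mult gt h)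
    show "\<forall>\<^sub>F x in p. d\<^sup>2 - 7 * \<rho> \<le> avg (\<Phi> (r j)) (\<lambda>n. P (n + x) * a (n + x))"
      using PZ mean_a by (intro ev_p[of j]) auto
  qed
  have Qh: "\<bar>avg (\<Phi> (r j)) (\<lambda>n. (a (n + m) - Q j (n + m)) * h n)\<bar> \<le> (1/2) ^ j" if "m \<le> j" for j m
  proof (rule tendsto_upperbound[OF _ _ p_nt])
    show "((\<lambda>x. \<bar>avg (\<Phi> (r j)) (\<lambda>n. (a (n + m) - Q j (n + m)) * a (n + x))\<bar>)
      \<longlongrightarrow> \<bar>avg (\<Phi> (r j)) (\<lambda>n. (a (n + m) - Q j (n + m)) * h n)\<bar>) p"
      by (intro tendsto_rabs tendsto_avg tendsto_mult tendsto_const h)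
    show "\<forall>\<^sub>F x in p. \<bar>avg (\<Phi> (r j)) (\<lambda>n. (a (n + m) - Q j (n + m)) * a (n + x))\<bar> \<le> (1/2) ^ j"
      using QU that by (intro ev_p[of j]) auto
  qed
  define x where "x m j = avg (\<Phi> (r j)) (\<lambda>n. a (n + m) * h n)" for m j
  \<comment> \<open>Split the translate of \<open>a\<close> into its residual from
    \<open>Q j\<close>, the error from \<open>Q j\<close> to \<open>P\<close>, the error from
    \<open>P\<close> to \<open>g\<close>, and \<open>g\<close>.\<close>
  have x_low: "x m j \<ge> d\<^sup>2 - 11 * \<rho> - (1/2) ^ j"
    if "m \<le> j" and m: "\<And>n. \<bar>P (n + m) - g n\<bar> \<le> \<rho>" for m j
  proof -
    have bQ': "bdd (\<lambda>n. Q j (n + m))" using bQ[rule_format] by (rule bdd_compose)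
    note bds [simp] = bQ' bP bg bh
    define u1 where "u1 = avg (\<Phi> (r j)) (\<lambda>n. (a (n + m) - Q j (n + m)) * h n)"
    define u2 where "u2 = avg (\<Phi> (r j)) (\<lambda>n. (Q j (n + m) - P (n + m)) * h n)"
    define u3 where "u3 = avg (\<Phi> (r j)) (\<lambda>n. (P (n + m) - g n) * h n)"
    define u4 where "u4 = avg (\<Phi> (r j)) (\<lambda>n. g n * h n)"
    have "x m j = u1 + u2 + u3 + u4"
      unfolding x_def u1_def u2_def u3_def u4_def
      by (simp add: av.L_add[symmetric] algebra_simps)
    moreover have "\<bar>u1\<bar> \<le> (1/2) ^ j" unfolding u1_def by (rule Qh[OF that(1)])
    moreover have "\<bar>u2\<bar> \<le> 3 * \<rho>"
    proof (rule abs_le_of_square_le)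
      have "u2\<^sup>2 \<le> avg (\<Phi> (r j)) (\<lambda>n. (Q j (n + m) - P (n + m))\<^sup>2) * avg (\<Phi> (r j)) (\<lambda>n. (h n)\<^sup>2)"
        unfolding u2_def by (rule av.L_Cauchy_Schwarz) auto
      also have "\<dots> \<le> (9 * \<rho>\<^sup>2) * 1"
      proof (intro mult_mono QP[rule_format] that(1))
        have "\<bar>avg (\<Phi> (r j)) (\<lambda>n. (h n)\<^sup>2)\<bar> \<le> 1"
          using h1 by (intro av.L_le_const) (simp add: abs_square_le_1)
        then show "avg (\<Phi> (r j)) (\<lambda>n. (h n)\<^sup>2) \<le> 1" by simp
      qed (auto intro!: av.L_nonneg)
      finally show "u2\<^sup>2 \<le> (3 * \<rho>)\<^sup>2" by (simp add: power_mult_distrib)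
    qed (use \<rho> in simp)
    moreover have "\<bar>u3\<bar> \<le> \<rho>"
      unfolding u3_def
    proof (rule av.L_le_const)
      fix n
      have "\<bar>P (n + m) - g n\<bar> * \<bar>h n\<bar> \<le> \<rho> * 1"
        using m h1 \<rho> by (intro mult_mono) auto
      then show "\<bar>(P (n + m) - g n) * h n\<bar> \<le> \<rho>" by (simp add: abs_mult)
    qed
    moreover have "u4 \<ge> d\<^sup>2 - 7 * \<rho>" unfolding u4_def by (rule gh)
    ultimately show ?thesis by linarith
  qed
  have x1: "\<bar>x m j\<bar> \<le> 1" for m j
    unfolding x_def by (intro av.L_le_const abs_mult_le_1 h1 a_abs)
  have "\<exists>l. (x m \<longlongrightarrow> l) F" for m
    using ultra_bounded_tendsto[OF F(1), of "x m", OF x1] .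
  then have "\<exists>L. \<forall>m. (x m \<longlongrightarrow> L m) F" by (intro choice allI)
  then obtain L where L: "\<And>m. (x m \<longlongrightarrow> L m) F" by blast
  \<comment> \<open>Diagonal choice: controlling all \<open>m \<le> i\<close> at stage
    \<open>i\<close> gives ordinary convergence for every \<open>m\<close> along one
    subsequence.\<close>
  have "\<forall>\<^sub>F j in F. \<forall>m\<in>{..i}. dist (x m j) (L m) < inverse (real (Suc i))" for i
    by (intro eventually_ball_finite ballI tendstoD[OF L]) auto
  then obtain s where s: "strict_mono s"
    and sL: "\<And>i. \<forall>m\<in>{..i}. dist (x m (s i)) (L m) < inverse (real (Suc i))"
    using choose_subsequence[of "\<lambda>i j. \<forall>m\<in>{..i}. dist (x m j) (L m) < inverse (real (Suc i))"]
    by blast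
  have xL: "(\<lambda>i. x m (s i)) \<longlonglongrightarrow> L m" for m
  proof (rule metric_tendsto_imp_tendsto[OF LIMSEQ_inverse_real_of_nat])
    show "\<forall>\<^sub>F i in sequentially. dist (x m (s i)) (L m) \<le> dist (inverse (real (Suc i))) 0"
      using eventually_ge_at_top[of m]
    proof eventually_elim
      case (elim i)
      then have "dist (x m (s i)) (L m) < inverse (real (Suc i))" using sL by simp
      then show ?case by (simp add: dist_real_def)
    qed
  qed
  define R where "R = r \<circ> s"
  have R: "strict_mono R" unfolding R_def using r s by (rule strict_mono_o)
  note folR = folner_subseq[OF assms(1) R]
  define p' where "p' = {X. \<forall>\<^sub>F x in p. x \<in> X}"
  have densx: "dens_seq (\<Phi> \<circ> R) (shift_set A m \<inter> shift_uf A p') = (\<lambda>i. x m (s i))" for m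
  proof
    fix i
    have "of_bool (n \<in> shift_set A m \<inter> shift_uf A p') = a (n + m) * h n" for n
      by (auto simp: shift_set_def shift_uf_def p'_def a_def h_def)
    then show "dens_seq (\<Phi> \<circ> R) (shift_set A m \<inter> shift_uf A p') i = x m (s i)"
      unfolding dens_seq_avg[OF folR] x_def by (simp add: R_def)
  qed
  have dens_L: "dens (\<Phi> \<circ> R) (shift_set A m \<inter> shift_uf A p') = L m" for m
    unfolding dens_def densx by (rule limI[OF xL])
  have dens_d: "dens (\<Phi> \<circ> R) A = d"
  proof -
    have "dens_seq (\<Phi> \<circ> R) A = dens_seq \<Phi> A \<circ> R" by (auto simp: dens_seq_def)
    then show ?thesis
      unfolding dens_def using LIMSEQ_subseq_LIMSEQ[OF d R] by (simp add: limI)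
  qed
  have L1: "\<bar>L m\<bar> \<le> 1" for m
    by (rule tendsto_upperbound[OF tendsto_rabs[OF L] _ F_nontrivial]) (simp add: x1)
  obtain l where l: "(L \<longlongrightarrow> l) p" using ultra_bounded_tendsto[OF p(1), of L, OF L1] by blast
  have "l \<ge> d\<^sup>2 - 11 * \<rho>"
  proof (rule tendsto_lowerbound[OF l _ p_nt])
    \<comment> \<open>For \<open>p\<close>-most \<open>m\<close> the translate of \<open>P\<close>
      is uniformly within \<open>\<rho>\<close> of \<open>g\<close>; with such \<open>m\<close>
      fixed, \<open>j\<close> runs along \<open>F\<close> and the error \<open>(1/2) ^ j\<close>
      vanishes.\<close>
    show "\<forall>\<^sub>F m in p. d\<^sup>2 - 11 * \<rho> \<le> L m"
      using g[OF \<rho>(1)]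
    proof eventually_elim
      case (elim m)
      have "((\<lambda>j. d\<^sup>2 - 11 * \<rho> - (1/2) ^ j) \<longlongrightarrow> d\<^sup>2 - 11 * \<rho> - 0) F"
        by (intro tendsto_F tendsto_intros LIMSEQ_power_zero) simp
      moreover have "\<forall>\<^sub>F j in F. d\<^sup>2 - 11 * \<rho> - (1/2) ^ j \<le> x m j"
        by (rule eventually_mono[OF filter_leD[OF F(2) eventually_ge_at_top[of m]]])
          (use x_low elim in blast)
      ultimately have "d\<^sup>2 - 11 * \<rho> - 0 \<le> L m"
        by (intro tendsto_le[OF F_nontrivial L])
      then show ?case by simp
    qed
  qed
  moreover have "ulim p' L = l" unfolding p'_def by (rule ulim_eq[OF p(1) l])
  ultimately have "ulim p' (\<lambda>m. dens (\<Phi> \<circ> R) (shift_set A m \<inter> shift_uf A p')) \<ge> (dens (\<Phi> \<circ> R) A)\<^sup>2 - \<epsilon>"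
    unfolding dens_L dens_d using \<rho>(3) by simp
  moreover have "dens_exists (\<Phi> \<circ> R) (shift_set A m \<inter> shift_uf A p')" for m
    unfolding dens_exists_def densx using xL by (rule convergentI)
  moreover have "ultrafilter_nat p'" "nonprincipal p'"
    unfolding p'_def by (rule ultrafilter_nat_of_filter[OF p(1)], rule nonprincipal_of_filter[OF p(1) p_seq])
  ultimately show ?thesis using R folR by blast
qed

end
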